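(* Let $m\ge2$ be an integer and $\zeta$ a $U_m$-number. Then $\lambda_n(\zeta)\ge\frac{1}{m-1}$ for all $n\ge1$. Furthermore, $w_{m-1}(\zeta)=m-1$ holds if and only if \[\lambda_n(\zeta)=\lambda_{n,2}(\zeta)=\cdots=\lambda_{n,m}(\zeta)=\frac{1}{m-1}\qquad\text{for all } n\ge m-1.\] Moreover, $w_1(\zeta)=w\in[1,2]$ and $w_t(\zeta)=t$ for all $2\le t\le m-1$ hold if and only if the sequence $(\lambda_n(\zeta))_{n\ge1}$ equals \[\Big(w,\tfrac12,\tfrac13,\dots,\tfrac{1}{m-2},\tfrac{1}{m-1},\tfrac{1}{m-1},\tfrac{1}{m-1},\dots\Big),\] i.e. $\lambda_1(\zeta)=w$, $\lambda_n(\zeta)=1/n$ for $2\le n\le m-1$, and $\lambda_n(\zeta)=1/(m-1)$ for all $n\ge m$.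
   Context: $H(P)$ is the maximum modulus of the coefficients of $P\in\mathbb{Z}[T]$. $w_n(\zeta)$: supremum of $w$ such that $0<|P(\zeta)|\le H(P)^{-w}$ has infinitely many solutions $P\in\mathbb{Z}[T]$ of degree $\le n$. $\zeta$ is a $U_m$-number if $w_m(\zeta)=\infty$ and $m$ is the smallest such index. For $1\le j\le n+1$, $\lambda_{n,j}(\zeta)$ is the supremum of $\lambda$ such that the system $1\le|x|\le X$, $\max_{1\le i\le n}|\zeta^ix-y_i|\le X^{-\lambda}$ has $j$ linearly independent solutions $(x,y_1,\dots,y_n)\in\mathbb{Z}^{n+1}$ for arbitrarily large $X$; $\lambda_n(\zeta)=\lambda_{n,1}(\zeta)$. *)

theory Defs
  imports Complex_Main "HOL-Library.Extended_Real" "HOL-Computational_Algebra.Polynomial"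
begin

definition poly_height :: "int poly \<Rightarrow> int" where
  "poly_height P = Max ((\<lambda>i. \<bar>coeff P i\<bar>) ` {..degree P})"

definition w_exponent :: "nat \<Rightarrow> real \<Rightarrow> ereal" where
  "w_exponent n \<zeta> = Sup {ereal w | w :: real.
     infinite {P :: int poly. degree P \<le> n \<and>
       0 < \<bar>poly (map_poly of_int P) \<zeta>\<bar> \<and>
       \<bar>poly (map_poly of_int P) \<zeta>\<bar> \<le> real_of_int (poly_height P) powr (- w)}}"

definition U_number :: "nat \<Rightarrow> real \<Rightarrow> bool" where
  "U_number m \<zeta> \<longleftrightarrow> m \<ge> 1 \<and> w_exponent m \<zeta> = \<infinity> \<and>
     (\<forall>k. 1 \<le> k \<and> k < m \<longrightarrow> w_exponent k \<zeta> \<noteq> \<infinity>)"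

text \<open>A vector of \<open>\<int>\<^sup>n\<^sup>+\<^sup>1\<close> is represented by the values of a function on \<open>{0..n}\<close>; values
  beyond \<open>n\<close> are ignored. For integer vectors, linear independence over the integers, the
  rationals and the reals coincide.\<close>

definition lin_indep_int :: "nat \<Rightarrow> nat \<Rightarrow> (nat \<Rightarrow> nat \<Rightarrow> int) \<Rightarrow> bool" where
  "lin_indep_int n j v \<longleftrightarrow>
     (\<forall>c :: nat \<Rightarrow> int. (\<forall>i\<le>n. (\<Sum>k<j. c k * v k i) = 0) \<longrightarrow> (\<forall>k<j. c k = 0))"

text \<open>The component \<open>u 0\<close> plays the role of \<open>x\<close>, and \<open>u i\<close> that of \<open>y\<^sub>i\<close> for \<open>1 \<le> i \<le> n\<close>.\<close>

definition simult_approx :: "nat \<Rightarrow> real \<Rightarrow> real \<Rightarrow> real \<Rightarrow> (nat \<Rightarrow> int) \<Rightarrow> bool" where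
  "simult_approx n \<zeta> l X u \<longleftrightarrow>
     1 \<le> \<bar>u 0\<bar> \<and> real_of_int \<bar>u 0\<bar> \<le> X \<and>
     (\<forall>i\<in>{1..n}. \<bar>\<zeta> ^ i * real_of_int (u 0) - real_of_int (u i)\<bar> \<le> X powr (- l))"

definition lambda_exponent :: "nat \<Rightarrow> nat \<Rightarrow> real \<Rightarrow> ereal" where
  "lambda_exponent n j \<zeta> = Sup {ereal l | l :: real.
     \<forall>X\<^sub>0 :: real. \<exists>X\<ge>X\<^sub>0. \<exists>v. lin_indep_int n j v \<and> (\<forall>k<j. simult_approx n \<zeta> l X (v k))}"

end

theory Submission imports Defs "HOL-Library.FuncSet" begin

text \<open>
  Let \<open>h = m - 1\<close>. By Liouville's inequality \<open>\<zeta>\<close> is transcendental, so Khintchine's transference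
  principle gives \<open>w\<^sub>n = n\<close> iff \<open>\<lambda>\<^sub>n = 1/n\<close>, and \<open>w\<^sub>1 = \<lambda>\<^sub>1\<close>. A polynomial \<open>P\<close> of degree \<open>m\<close>, height \<open>H\<close>
  and leading coefficient \<open>a\<close> with extremely small \<open>P(\<zeta>)\<close> almost makes \<open>\<zeta>\<close> algebraic of degree \<open>m\<close>:
  multiplying by \<open>a^(n - h)\<close> prolongs every simultaneous approximation of \<open>\<zeta>, ..., \<zeta>^h\<close> with
  \<open>X = H^K\<close>, \<open>K\<close> large, to one of \<open>\<zeta>, ..., \<zeta>^n\<close> of almost the same quality. Dirichlet's theorem in
  dimension \<open>h\<close> then yields \<open>\<lambda>\<^sub>n \<ge> 1/h\<close>. If \<open>\<lambda>\<^sub>h = 1/h\<close>, no approximation in dimension \<open>h\<close> is much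
  better than Dirichlet's, and a packing argument shows that for every large \<open>X\<close> there are \<open>h + 1\<close>
  linearly independent approximations of almost that quality, which prolong as well.
\<close>

section \<open>Admissible exponents\<close>

text \<open>A polynomial \<open>P\<close> with tiny value prescribes the scale: its height
  \<open>H\<close> forces \<open>X = H^K\<close>, and nothing is known about which heights occur.
  Solutions at some arbitrarily large \<open>X\<close> are therefore useless for prolongation; its
  input must be solvable at every large \<open>X\<close>. Dirichlet's theorem has this form, and so
  has the packing argument, which stands in for Minkowski's second theorem: once
  \<open>\<lambda>\<^sub>h = 1/h\<close>, slightly shrunken Dirichlet boxes contain no approximation
  at any large scale. The factor \<open>a^(n - h)\<close> costs a fixed power of \<open>H\<close> in
  size and in error, hence nothing in the exponent as \<open>K\<close> grows, and
  \<open>w\<^sub>m = \<infinity>\<close> permits every \<open>K\<close>. One case of the third claim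
  lies outside this scheme. For \<open>m \<ge> 3\<close> the condition \<open>w\<^sub>h = h\<close>
  is among those assumed, and the second claim applies. For \<open>m = 2\<close>, however,
  \<open>h = 1\<close> and \<open>w\<^sub>1 = w\<close> may exceed 1. There
  \<open>\<lambda>\<^sub>2 \<le> 1\<close> comes from a gcd argument:
  \<open>\<lambda>\<^sub>2 > 1\<close> would force
  \<open>\<lambda>\<^sub>1 \<ge> 2 \<lambda>\<^sub>2 > 2\<close>.\<close>

definition w_approximants :: "nat \<Rightarrow> real \<Rightarrow> real \<Rightarrow> int poly set" where
  "w_approximants n \<zeta> w = {P. degree P \<le> n \<and> 0 < \<bar>poly (map_poly of_int P) \<zeta>\<bar> \<and>
     \<bar>poly (map_poly of_int P) \<zeta>\<bar> \<le> real_of_int (poly_height P) powr (- w)}"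

text \<open>The scale \<open>X\<close> is kept as an argument because two quantifiers over it occur:
  arbitrarily large \<open>X\<close> in \<open>lambda_admissible\<close>, every large
  \<open>X\<close> in \<open>lambda_uniform\<close>.\<close>

definition lambda_solvable :: "nat \<Rightarrow> nat \<Rightarrow> real \<Rightarrow> real \<Rightarrow> real \<Rightarrow> bool" where
  "lambda_solvable n j \<zeta> l X \<longleftrightarrow>
     (\<exists>v. lin_indep_int n j v \<and> (\<forall>k<j. simult_approx n \<zeta> l X (v k)))"

definition lambda_admissible :: "nat \<Rightarrow> nat \<Rightarrow> real \<Rightarrow> real \<Rightarrow> bool" where
  "lambda_admissible n j \<zeta> l \<longleftrightarrow> (\<forall>X\<^sub>0. \<exists>X\<ge>X\<^sub>0. lambda_solvable n j \<zeta> l X)"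

lemma lambda_exponent_alt:
  "lambda_exponent n j \<zeta> = Sup {ereal l | l. lambda_admissible n j \<zeta> l}"
  unfolding lambda_exponent_def lambda_admissible_def lambda_solvable_def ..

lemma w_exponent_alt: "w_exponent n \<zeta> = Sup {ereal w | w. infinite (w_approximants n \<zeta> w)}"
  unfolding w_exponent_def w_approximants_def ..

section \<open>Heights and values of integer polynomials\<close>

lemma abs_coeff_le_height: "\<bar>coeff P i\<bar> \<le> poly_height P"
proof (cases "i \<le> degree P")
  case True
  then show ?thesis unfolding poly_height_def by (intro Max_ge) auto
next
  case False
  have "\<bar>coeff P 0\<bar> \<le> poly_height P"
    unfolding poly_height_def by (intro Max_ge) auto
  with False show ?thesis by (simp add: coeff_eq_0)
qed

lemma height_le: "(\<And>i. \<bar>coeff P i\<bar> \<le> B) \<Longrightarrow> poly_height P \<le> B"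
  unfolding poly_height_def by (subst Max_le_iff) auto

lemma height_ge_1: "P \<noteq> 0 \<Longrightarrow> poly_height P \<ge> 1"
  using abs_coeff_le_height[of P "degree P"] leading_coeff_0_iff[of P] by linarith

lemma abs_power_le_max_power:
  fixes \<zeta> :: real
  assumes "i \<le> n"
  shows "\<bar>\<zeta>\<bar> ^ i \<le> max 1 \<bar>\<zeta>\<bar> ^ n"
proof -
  have "\<bar>\<zeta>\<bar> ^ i \<le> max 1 \<bar>\<zeta>\<bar> ^ i" by (intro power_mono) auto
  also have "\<dots> \<le> max 1 \<bar>\<zeta>\<bar> ^ n" using assms by (intro power_increasing) auto
  finally show ?thesis .
qed

lemma height_attained: "\<exists>k\<le>degree P. \<bar>coeff P k\<bar> = poly_height P"
proof -
  have "poly_height P \<in> (\<lambda>i. \<bar>coeff P i\<bar>) ` {..degree P}"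
    unfolding poly_height_def by (intro Max_in) auto
  then show ?thesis by auto
qed

lemma finite_bounded_height: "finite {P. degree P \<le> n \<and> poly_height P \<le> B}"
proof -
  have "{P. degree P \<le> n \<and> poly_height P \<le> B} \<subseteq> Poly ` {xs. set xs \<subseteq> {-B..B} \<and> length xs \<le> Suc n}"
  proof
    fix P :: "int poly" assume "P \<in> {P. degree P \<le> n \<and> poly_height P \<le> B}"
    then have d: "degree P \<le> n" and h: "poly_height P \<le> B" by auto
    have "\<bar>c\<bar> \<le> B" if c: "c \<in> set (coeffs P)" for c
    proof -
      from c have "c \<in> range (coeff P)" using range_coeff[of P] by auto
      then obtain i where "c = coeff P i" by auto
      with abs_coeff_le_height[of P i] h show ?thesis by simp
    qed
    then have "set (coeffs P) \<subseteq> {-B..B}" by (fastforce simp: abs_le_iff)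
    moreover have "length (coeffs P) \<le> Suc n"
      using d by (cases "P = 0") (auto simp: length_coeffs_degree)
    ultimately show "P \<in> Poly ` {xs. set xs \<subseteq> {-B..B} \<and> length xs \<le> Suc n}"
      by (intro image_eqI[of _ _ "coeffs P"]) auto
  qed
  then show ?thesis
    by (rule finite_subset) (intro finite_imageI finite_lists_length_le, simp)
qed

lemma degree_of_int_poly: "degree (map_poly (of_int :: int \<Rightarrow> real) P) = degree P"
  by (intro degree_map_poly) auto

lemma poly_of_int_eq_sum:
  assumes "degree P \<le> n"
  shows "poly (map_poly of_int P) (x::real) = (\<Sum>i\<le>n. of_int (coeff P i) * x ^ i)"
proof -
  have "poly (map_poly of_int P) x = (\<Sum>i\<le>degree P. of_int (coeff P i) * x ^ i)"
    by (simp add: poly_altdef degree_of_int_poly coeff_map_poly)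
  also have "\<dots> = (\<Sum>i\<le>n. of_int (coeff P i) * x ^ i)"
    using assms by (intro sum.mono_neutral_left) (auto simp: coeff_eq_0)
  finally show ?thesis .
qed

lemma exists_poly_with_coeffs:
  fixes c :: "nat \<Rightarrow> int"
  obtains P where "degree P \<le> n" "\<And>i. coeff P i = (if i \<le> n then c i else 0)"
proof
  let ?P = "\<Sum>i\<le>n. monom (c i) i"
  show "coeff ?P i = (if i \<le> n then c i else 0)" for i
    by (simp add: coeff_sum)
  then show "degree ?P \<le> n" by (intro degree_le) auto
qed

text \<open>Only finitely many polynomials have bounded degree and height. This turns "infinitely
  many" into "of height as large as desired", the form in which approximants are used later.\<close>

lemma w_approximants_unbounded:
  assumes "infinite (w_approximants n \<zeta> w)"
  obtains P where "P \<in> w_approximants n \<zeta> w" "real_of_int (poly_height P) \<ge> B"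
proof -
  have "\<exists>P\<in>w_approximants n \<zeta> w. real_of_int (poly_height P) \<ge> B"
  proof (rule ccontr)
    assume "\<not> ?thesis"
    then have "w_approximants n \<zeta> w \<subseteq> {P. degree P \<le> n \<and> poly_height P \<le> \<lceil>B\<rceil>}"
      by (auto simp: w_approximants_def) (smt (verit) le_of_int_ceiling of_int_le_iff)
    with finite_bounded_height assms show False by (meson finite_subset)
  qed
  then show ?thesis using that by blast
qed

lemma w_approximants_nonzero: "P \<in> w_approximants n \<zeta> w \<Longrightarrow> P \<noteq> 0"
  by (auto simp: w_approximants_def)

lemma w_approximants_antimono:
  assumes "w \<le> w'"
  shows "w_approximants n \<zeta> w' \<subseteq> w_approximants n \<zeta> w"
proof
  fix P assume P: "P \<in> w_approximants n \<zeta> w'"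
  then have "poly_height P \<ge> 1" using height_ge_1 w_approximants_nonzero by blast
  then have "real_of_int (poly_height P) powr - w' \<le> real_of_int (poly_height P) powr - w"
    using assms by (intro powr_mono) auto
  with P show "P \<in> w_approximants n \<zeta> w" by (auto simp: w_approximants_def)
qed

lemma infinite_approximants_if_less_w:
  assumes "ereal w < w_exponent n \<zeta>"
  shows "infinite (w_approximants n \<zeta> w)"
proof -
  from assms obtain w' where "w < w'" "infinite (w_approximants n \<zeta> w')"
    unfolding w_exponent_alt less_Sup_iff by auto
  with w_approximants_antimono[of w w' n \<zeta>] show ?thesis
    by (meson finite_subset less_imp_le)
qed

lemma w_exponent_ge: "infinite (w_approximants n \<zeta> w) \<Longrightarrow> ereal w \<le> w_exponent n \<zeta>"
  unfolding w_exponent_alt by (rule Sup_upper) auto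

section \<open>Monotonicity in the exponent, the number of vectors and the dimension\<close>

lemma simult_approx_antimono:
  assumes "l \<le> l'" "simult_approx n \<zeta> l' X u"
  shows "simult_approx n \<zeta> l X u"
proof -
  have "X \<ge> 1" using assms(2) unfolding simult_approx_def by linarith
  then have "X powr - l' \<le> X powr - l" using assms(1) by (intro powr_mono) auto
  with assms(2) show ?thesis unfolding simult_approx_def by (meson order_trans)
qed

lemma lambda_admissible_antimono:
  "l \<le> l' \<Longrightarrow> lambda_admissible n j \<zeta> l' \<Longrightarrow> lambda_admissible n j \<zeta> l"
  unfolding lambda_admissible_def lambda_solvable_def by (meson simult_approx_antimono)

lemma lambda_admissible_if_less:
  "ereal l < lambda_exponent n j \<zeta> \<Longrightarrow> lambda_admissible n j \<zeta> l"
  unfolding lambda_exponent_alt less_Sup_iff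
  by (auto dest: lambda_admissible_antimono[OF less_imp_le])

lemma lambda_exponent_ge: "lambda_admissible n j \<zeta> l \<Longrightarrow> ereal l \<le> lambda_exponent n j \<zeta>"
  unfolding lambda_exponent_alt by (rule Sup_upper) auto

lemma ereal_le_if_reals_below:
  fixes a b :: ereal
  assumes "\<And>z. ereal z < a \<Longrightarrow> ereal z \<le> b"
  shows "a \<le> b"
  using assms by (meson dense ereal_dense2 leD leI)

lemma lin_indep_int_1: "u 0 \<noteq> 0 \<Longrightarrow> lin_indep_int n 1 (\<lambda>_. u)"
  unfolding lin_indep_int_def by auto

text \<open>The first entry of a solution is nonzero, so a single solution is independent by itself;
  exponents with \<open>j = 1\<close> can be handled without families of vectors.\<close>

lemma lambda_solvable_1_iff: "lambda_solvable n 1 \<zeta> l X \<longleftrightarrow> (\<exists>u. simult_approx n \<zeta> l X u)"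
proof
  assume "\<exists>u. simult_approx n \<zeta> l X u"
  then obtain u where u: "simult_approx n \<zeta> l X u" by auto
  then have "u 0 \<noteq> 0" unfolding simult_approx_def by auto
  from lin_indep_int_1[of u, OF this] u show "lambda_solvable n 1 \<zeta> l X"
    unfolding lambda_solvable_def by blast
qed (auto simp: lambda_solvable_def)

lemma lin_indep_int_fewer:
  assumes "lin_indep_int n j v" "i \<le> j"
  shows "lin_indep_int n i v"
  unfolding lin_indep_int_def
proof (intro allI impI)
  fix c :: "nat \<Rightarrow> int" and k
  assume c: "\<forall>r\<le>n. (\<Sum>k<i. c k * v k r) = 0" and k: "k < i"
  define c' where "c' = (\<lambda>k. if k < i then c k else 0)"
  have "(\<Sum>k<j. c' k * v k r) = (\<Sum>k<i. c k * v k r)" for r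
    using assms(2) by (intro sum.mono_neutral_cong_right) (auto simp: c'_def)
  with c assms(1) have "\<forall>k<j. c' k = 0" unfolding lin_indep_int_def by auto
  with k assms(2) show "c k = 0" unfolding c'_def by (metis order_less_le_trans)
qed

lemma lambda_admissible_fewer:
  "lambda_admissible n j \<zeta> l \<Longrightarrow> i \<le> j \<Longrightarrow> lambda_admissible n i \<zeta> l"
  unfolding lambda_admissible_def lambda_solvable_def
  by (meson lin_indep_int_fewer order_less_le_trans)

lemma lambda_admissible_lower_dim:
  "lambda_admissible n 1 \<zeta> l \<Longrightarrow> k \<le> n \<Longrightarrow> lambda_admissible k 1 \<zeta> l"
  unfolding lambda_admissible_def lambda_solvable_1_iff simult_approx_def
  by (meson atLeastAtMost_iff order_trans)

text \<open>Absorbs constants: the estimates below leave a strict gap in the exponent, and the gap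
  eventually outweighs any constant factor.\<close>

lemma const_le_powr:
  assumes "(e::real) > 0"
  obtains X\<^sub>0 where "X\<^sub>0 \<ge> 1" "\<And>X. X \<ge> X\<^sub>0 \<Longrightarrow> C \<le> X powr e"
proof
  let ?X = "(\<bar>C\<bar> + 1) powr (1 / e)"
  show "?X \<ge> 1" using assms by (intro ge_one_powr_ge_zero) auto
  fix X assume X: "X \<ge> ?X"
  have "C \<le> \<bar>C\<bar> + 1" by simp
  also have "\<dots> = ?X powr e" using assms by (simp add: powr_powr)
  also have "\<dots> \<le> X powr e" using X assms by (intro powr_mono2) auto
  finally show "C \<le> X powr e" .
qed

section \<open>Pigeonhole arguments\<close>

lemma pigeonhole_many:
  assumes "finite A" "finite B" "f ` A \<subseteq> B" "card A > k * card B"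
  shows "\<exists>y\<in>B. card {x \<in> A. f x = y} > k"
proof (rule ccontr)
  assume *: "\<not> ?thesis"
  have "A = (\<Union>y\<in>B. {x \<in> A. f x = y})" using assms(3) by auto
  then have "card A \<le> (\<Sum>y\<in>B. card {x \<in> A. f x = y})"
    using card_UN_le[OF assms(2)] by metis
  also have "\<dots> \<le> (\<Sum>y\<in>B. k)" using * by (intro sum_mono) auto
  finally show False using assms(4) by (simp add: mult.commute)
qed

text \<open>The vectors with entries in \<open>{0..A}\<close> outnumber the possible values of the
  \<open>M\<close> linear forms, and two vectors with equal values differ by a solution.\<close>

lemma siegel:
  fixes b :: "nat \<Rightarrow> nat \<Rightarrow> int" and A B M N :: nat
  assumes B: "\<And>j. j < M \<Longrightarrow> (\<Sum>i<N. \<bar>b j i\<bar>) \<le> int B"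
    and less: "(2 * A * B + 1) ^ M < (A + 1) ^ N"
  shows "\<exists>c. (\<exists>i<N. c i \<noteq> 0) \<and> (\<forall>i<N. \<bar>c i\<bar> \<le> int A) \<and> (\<forall>j<M. (\<Sum>i<N. c i * b j i) = 0)"
proof -
  let ?S = "{..<N} \<rightarrow>\<^sub>E {0..int A}"
  let ?T = "{..<M} \<rightarrow>\<^sub>E {-int (A * B)..int (A * B)}"
  let ?f = "\<lambda>x. \<lambda>j\<in>{..<M}. \<Sum>i<N. x i * b j i"
  have cS: "card ?S = (A + 1) ^ N" by (simp add: card_PiE nat_add_distrib)
  have "nat (1 + 2 * (int A * int B)) = 1 + 2 * (A * B)"
    by (metis nat_int of_nat_1 of_nat_add of_nat_mult of_nat_numeral)
  then have cT: "card ?T = (2 * A * B + 1) ^ M" by (simp add: card_PiE algebra_simps)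
  have img: "?f ` ?S \<subseteq> ?T"
  proof (intro image_subsetI PiE_I)
    fix x j assume x: "x \<in> ?S" and j: "j \<in> {..<M}"
    have "\<bar>\<Sum>i<N. x i * b j i\<bar> \<le> (\<Sum>i<N. int A * \<bar>b j i\<bar>)"
      using x by (intro order_trans[OF sum_abs] sum_mono)
        (auto simp: abs_mult PiE_iff intro!: mult_right_mono)
    also have "\<dots> \<le> int A * int B"
      using B[of j] j by (simp add: sum_distrib_left[symmetric] mult_left_mono)
    finally show "?f x j \<in> {-int (A * B)..int (A * B)}" using j by auto
  qed auto
  have "\<not> inj_on ?f ?S"
    using card_inj_on_le[of ?f ?S ?T, OF _ img] cS cT less by (auto simp: finite_PiE)
  then obtain x y where xy: "x \<in> ?S" "y \<in> ?S" "x \<noteq> y" "?f x = ?f y"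
    unfolding inj_on_def by blast
  show ?thesis
  proof (intro exI[of _ "\<lambda>i. x i - y i"] conjI allI impI)
    show "\<exists>i<N. x i - y i \<noteq> 0"
      using xy PiE_ext[of x "{..<N}" "\<lambda>_. {0..int A}" y] by auto
    show "\<bar>x i - y i\<bar> \<le> int A" if "i < N" for i
      using xy that by (force simp: PiE_iff abs_le_iff)
    show "(\<Sum>i<N. (x i - y i) * b j i) = 0" if "j < M" for j
      using fun_cong[OF xy(4), of j] that by (simp add: left_diff_distrib sum_subtractf)
  qed
qed

corollary siegel_more_unknowns:
  fixes b :: "nat \<Rightarrow> nat \<Rightarrow> int" and B M N :: nat
  assumes B: "\<And>j. j < M \<Longrightarrow> (\<Sum>i<N. \<bar>b j i\<bar>) \<le> int B" and "M < N"
  shows "\<exists>c. (\<exists>i<N. c i \<noteq> 0) \<and> (\<forall>i<N. \<bar>c i\<bar> \<le> int ((2 * B + 1) ^ M)) \<and>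
    (\<forall>j<M. (\<Sum>i<N. c i * b j i) = 0)"
proof (rule siegel[OF B])
  \<comment> \<open>Chosen so that \<open>2 * A * B + 1 \<le> (A + 1) * (2 * B + 1)\<close>, the
    \<open>M\<close>-th power of the right side being \<open>(A + 1) ^ M * A\<close>, just below
    \<open>(A + 1) ^ Suc M\<close>.\<close>
  define A where "A = (2 * B + 1) ^ M"
  have "(2 * A * B + 1) ^ M \<le> ((A + 1) * (2 * B + 1)) ^ M"
    by (intro power_mono) auto
  also have "\<dots> = (A + 1) ^ M * A" unfolding A_def by (rule power_mult_distrib)
  also have "\<dots> < (A + 1) ^ Suc M" by simp
  also have "\<dots> \<le> (A + 1) ^ N" using \<open>M < N\<close> by (intro power_increasing) auto
  finally show "(2 * (2 * B + 1) ^ M * B + 1) ^ M < ((2 * B + 1) ^ M + 1) ^ N"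
    unfolding A_def .
qed

text \<open>The common pigeonhole behind three arguments: fractional parts are sorted into cells of
  side \<open>1 / Q\<close>, and the label \<open>g\<close> adds a side condition. It serves with
  \<open>k = 1\<close> for Dirichlet's theorem, with \<open>g\<close> a residue class for the
  transference, and with large \<open>k\<close> for the packing argument.\<close>

lemma many_close_multiples:
  fixes \<theta> :: "nat \<Rightarrow> real" and g :: "nat \<Rightarrow> 'b"
  assumes "finite I" "finite C" "\<And>x. g x \<in> C" "Q \<ge> 1"
    and less: "k * (Q ^ card I * card C) < M"
  obtains S where "S \<subseteq> {..<M}" "card S > k"
    "\<And>x y. x \<in> S \<Longrightarrow> y \<in> S \<Longrightarrow> g x = g y"
    "\<And>x y i. x \<in> S \<Longrightarrow> y \<in> S \<Longrightarrow> i \<in> I \<Longrightarrow> \<bar>frac (\<theta> i * x) - frac (\<theta> i * y)\<bar> \<le> 1 / real Q"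
proof -
  define f where "f = (\<lambda>x::nat. (\<lambda>i\<in>I. nat \<lfloor>real Q * frac (\<theta> i * x)\<rfloor>, g x))"
  let ?T = "(I \<rightarrow>\<^sub>E {..<Q}) \<times> C"
  have "f ` {..<M} \<subseteq> ?T"
  proof -
    have "nat \<lfloor>real Q * frac t\<rfloor> < Q" for t
    proof -
      have "real Q * frac t < real Q" using frac_lt_1[of t] \<open>Q \<ge> 1\<close> by simp
      moreover have "real Q * frac t \<ge> 0" by simp
      ultimately show ?thesis by linarith
    qed
    with assms(3) show ?thesis by (auto simp: f_def)
  qed
  moreover have "card ?T = Q ^ card I * card C"
    using assms by (simp add: card_PiE card_cartesian_product)
  moreover have "finite ?T" using assms by (auto intro: finite_PiE)
  ultimately obtain y where y: "card {x \<in> {..<M}. f x = y} > k"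
    using pigeonhole_many[of "{..<M}" ?T f k] less by auto
  show ?thesis
  proof (rule that[of "{x \<in> {..<M}. f x = y}"])
    fix x z i assume xz: "x \<in> {x \<in> {..<M}. f x = y}" "z \<in> {x \<in> {..<M}. f x = y}" and i: "i \<in> I"
    then have "fst (f x) i = fst (f z) i" by auto
    then have "nat \<lfloor>real Q * frac (\<theta> i * x)\<rfloor> = nat \<lfloor>real Q * frac (\<theta> i * z)\<rfloor>"
      using i by (simp add: f_def)
    moreover have "\<lfloor>real Q * frac (\<theta> i * x)\<rfloor> \<ge> 0" "\<lfloor>real Q * frac (\<theta> i * z)\<rfloor> \<ge> 0" by auto
    ultimately have "\<lfloor>real Q * frac (\<theta> i * x)\<rfloor> = \<lfloor>real Q * frac (\<theta> i * z)\<rfloor>" by linarith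
    then have "\<bar>real Q * frac (\<theta> i * x) - real Q * frac (\<theta> i * z)\<bar> \<le> 1" by linarith
    then have "real Q * \<bar>frac (\<theta> i * x) - frac (\<theta> i * z)\<bar> \<le> 1"
      by (simp add: abs_mult right_diff_distrib[symmetric])
    then show "\<bar>frac (\<theta> i * x) - frac (\<theta> i * z)\<bar> \<le> 1 / real Q"
      using \<open>Q \<ge> 1\<close> by (simp add: field_simps)
  qed (use y in \<open>auto simp: f_def\<close>)
qed

section \<open>Liouville's inequality\<close>

text \<open>\<open>\<zeta>\<close> times the leading coefficient is an algebraic integer: each
  factor \<open>lead_coeff Q\<close> pays for one use of the relation that removes
  \<open>\<zeta> ^ Suc e\<close>.\<close>

lemma scaled_power_reduction:
  fixes Q :: "int poly" and \<zeta> :: real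
  assumes "degree Q = Suc e" "poly (map_poly of_int Q) \<zeta> = 0"
  shows "\<exists>s :: nat \<Rightarrow> int. of_int (lead_coeff Q) ^ k * \<zeta> ^ k = (\<Sum>j\<le>e. of_int (s j) * \<zeta> ^ j)"
proof (induction k)
  case 0
  have "(\<Sum>j\<le>e. of_int (if j = 0 then 1 else 0) * \<zeta> ^ j) = 1"
    by (subst sum.remove[of _ 0]) auto
  then show ?case by (intro exI[of _ "\<lambda>j. if j = 0 then 1 else 0"]) simp
next
  case (Suc k)
  let ?q = "real_of_int (lead_coeff Q)"
  from Suc obtain s :: "nat \<Rightarrow> int" where s: "?q ^ k * \<zeta> ^ k = (\<Sum>j\<le>e. of_int (s j) * \<zeta> ^ j)" ..
  \<comment> \<open>Multiplication by \<open>lead_coeff Q * \<zeta>\<close> shifts the coordinates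
    up by one; the overflowing term at \<open>\<zeta> ^ Suc e\<close> is rewritten through
    \<open>Q\<close> into lower powers.\<close>
  define s' where "s' = (\<lambda>j. (if j = 0 then 0 else lead_coeff Q * s (j - 1)) - s e * coeff Q j)"
  have red: "?q * \<zeta> ^ Suc e = - (\<Sum>j\<le>e. of_int (coeff Q j) * \<zeta> ^ j)"
    using assms poly_of_int_eq_sum[of Q "Suc e" \<zeta>] by (simp add: algebra_simps)
  have "?q ^ Suc k * \<zeta> ^ Suc k = ?q * \<zeta> * (?q ^ k * \<zeta> ^ k)" by (simp add: algebra_simps)
  also have "\<dots> = (\<Sum>j\<le>e. ?q * of_int (s j) * \<zeta> ^ Suc j)"
    unfolding s by (simp add: sum_distrib_left algebra_simps)
  also have "\<dots> = (\<Sum>j<e. ?q * of_int (s j) * \<zeta> ^ Suc j) + of_int (s e) * (?q * \<zeta> ^ Suc e)"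
    by (simp add: lessThan_Suc_atMost[symmetric])
  also have "(\<Sum>j<e. ?q * of_int (s j) * \<zeta> ^ Suc j)
      = (\<Sum>j\<le>e. of_int (if j = 0 then 0 else lead_coeff Q * s (j - 1)) * \<zeta> ^ j)"
    by (simp only: lessThan_Suc_atMost[symmetric] sum.lessThan_Suc_shift) simp
  also have "of_int (s e) * (?q * \<zeta> ^ Suc e) = (\<Sum>j\<le>e. - of_int (s e * coeff Q j) * \<zeta> ^ j)"
    unfolding red by (simp add: sum_distrib_left sum_negf algebra_simps)
  finally have "?q ^ Suc k * \<zeta> ^ Suc k = (\<Sum>j\<le>e. of_int (s' j) * \<zeta> ^ j)"
    unfolding s'_def sum.distrib[symmetric] by (simp add: left_diff_distrib)
  then show ?case by blast
qed

lemma minimal_annihilator: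
  fixes \<zeta> :: real
  assumes "Q\<^sub>0 \<noteq> 0" "poly (map_poly of_int Q\<^sub>0) \<zeta> = 0"
  obtains Q e where "degree Q = Suc e" "poly (map_poly of_int Q) \<zeta> = 0"
    "\<And>R. R \<noteq> 0 \<Longrightarrow> degree R \<le> e \<Longrightarrow> poly (map_poly of_int R) \<zeta> \<noteq> 0"
proof -
  define Z where "Z = (\<lambda>d. \<exists>Q::int poly. Q \<noteq> 0 \<and> degree Q = d \<and> poly (map_poly of_int Q) \<zeta> = 0)"
  define d where "d = (LEAST d. Z d)"
  have "Z (degree Q\<^sub>0)" using assms unfolding Z_def by blast
  then have "Z d" unfolding d_def by (rule LeastI)
  then obtain Q where Q: "Q \<noteq> 0" "degree Q = d" "poly (map_poly of_int Q) \<zeta> = 0"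
    unfolding Z_def by auto
  have "d \<noteq> 0"
  proof
    assume "d = 0"
    with Q poly_of_int_eq_sum[of Q 0 \<zeta>] have "coeff Q (degree Q) = 0" by simp
    with leading_coeff_0_iff[of Q] Q(1) show False by blast
  qed
  then obtain e where e: "d = Suc e" using not0_implies_Suc by blast
  have "poly (map_poly of_int R) \<zeta> \<noteq> 0" if "R \<noteq> 0" "degree R \<le> e" for R
  proof -
    have "degree R < d" using that e by simp
    then have "\<not> Z (degree R)" unfolding d_def by (rule not_less_Least)
    with that show ?thesis unfolding Z_def by blast
  qed
  with Q e show ?thesis using that by blast
qed

text \<open>In place of norms, a cofactor \<open>R\<close> of degree at most \<open>e\<close> is
  chosen such that \<open>q ^ D * P(\<zeta>) * R(\<zeta>)\<close> has no component along
  \<open>\<zeta>, ..., \<zeta>^e\<close>, so that it is an integer. These are \<open>e\<close>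
  equations in \<open>e + 1\<close> unknowns, and Siegel's lemma gives \<open>R\<close> with
  coefficients of order \<open>H ^ e\<close>. Minimality of \<open>Q\<close> keeps
  \<open>R(\<zeta>)\<close> nonzero, so the integer has absolute value at least 1.\<close>

lemma liouville_inequality:
  fixes \<zeta> :: real and Q\<^sub>0 :: "int poly"
  assumes "Q\<^sub>0 \<noteq> 0" "poly (map_poly of_int Q\<^sub>0) \<zeta> = 0"
  obtains C :: real and e :: nat where "C > 0"
    "\<And>P. degree P \<le> n \<Longrightarrow> poly (map_poly of_int P) \<zeta> \<noteq> 0 \<Longrightarrow>
       1 \<le> C * real_of_int (poly_height P) ^ e * \<bar>poly (map_poly of_int P) \<zeta>\<bar>"
proof -
  from minimal_annihilator[OF assms] obtain Q e where Q: "degree Q = Suc e" "poly (map_poly of_int Q) \<zeta> = 0"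
    and min: "\<And>R. R \<noteq> 0 \<Longrightarrow> degree R \<le> e \<Longrightarrow> poly (map_poly of_int R) \<zeta> \<noteq> 0" by metis
  define q where "q = lead_coeff Q"
  have "Q \<noteq> 0" using Q by auto
  then have q0: "q \<noteq> 0" unfolding q_def by (simp only: leading_coeff_0_iff not_False_eq_True)
  \<comment> \<open>The product of \<open>P\<close> with a cofactor of degree at most
    \<open>e\<close> involves powers of \<open>\<zeta>\<close> up to \<open>n + e\<close>; a single
    factor \<open>q ^ D\<close> gives all of them integer coordinates.\<close>
  define D where "D = n + e"
  obtain s :: "nat \<Rightarrow> nat \<Rightarrow> int" where
    s: "\<And>k. of_int q ^ k * \<zeta> ^ k = (\<Sum>j\<le>e. of_int (s k j) * \<zeta> ^ j)"
    using scaled_power_reduction[OF Q] unfolding q_def by metis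
  define S where "S = (\<lambda>k j. q ^ (D - k) * s k j)"
  have S: "of_int q ^ D * \<zeta> ^ k = (\<Sum>j\<le>e. of_int (S k j) * \<zeta> ^ j)" if "k \<le> D" for k
  proof -
    have "of_int q ^ D * \<zeta> ^ k = of_int q ^ (D - k) * (of_int q ^ k * \<zeta> ^ k)"
      using that by (simp add: power_add[symmetric] mult.assoc[symmetric])
    also have "\<dots> = (\<Sum>j\<le>e. of_int (S k j) * \<zeta> ^ j)"
      unfolding s S_def by (simp add: sum_distrib_left algebra_simps)
    finally show ?thesis .
  qed
  define T where "T = nat (\<Sum>k\<le>D. \<Sum>j\<le>e. \<bar>S k j\<bar>)"
  have S_le: "\<bar>S k j\<bar> \<le> int T" if "k \<le> D" "j \<le> e" for k j
  proof -
    have "\<bar>S k j\<bar> \<le> (\<Sum>j\<le>e. \<bar>S k j\<bar>)" using that by (intro member_le_sum) auto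
    also have "\<dots> \<le> (\<Sum>k\<le>D. \<Sum>j\<le>e. \<bar>S k j\<bar>)"
      using that by (intro member_le_sum[of k "{..D}" "\<lambda>k. \<Sum>j\<le>e. \<bar>S k j\<bar>"]) (auto intro: sum_nonneg)
    finally show ?thesis unfolding T_def by (simp add: sum_nonneg)
  qed
  define t where "t = Suc e * (Suc n * T)"
  define c1 where "c1 = Suc (2 * t)"
  define Z where "Z = (\<Sum>i\<le>e. \<bar>\<zeta>\<bar> ^ i)"
  have Z: "Z > 0" unfolding Z_def by (rule sum_pos2[of _ 0]) auto
  define C where "C = \<bar>real_of_int q\<bar> ^ D * Z * real c1 ^ e"
  have "c1 > 0" unfolding c1_def by simp
  then have C: "C > 0" unfolding C_def using q0 Z by (intro mult_pos_pos zero_less_power) auto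
  show ?thesis
  proof (rule that[of C e])
    fix P :: "int poly" assume P: "degree P \<le> n" "poly (map_poly of_int P) \<zeta> \<noteq> 0"
    define H where "H = nat (poly_height P)"
    have "P \<noteq> 0" using P by auto
    then have H: "int H = poly_height P" "H \<ge> 1" using height_ge_1[of P] unfolding H_def by auto
    \<comment> \<open>\<open>b j i\<close> is the coordinate of
      \<open>q ^ D * P(\<zeta>) * \<zeta> ^ i\<close> along \<open>\<zeta> ^ j\<close>. The
      equations imposed below concern the coordinates \<open>Suc j\<close>; coordinate 0 stays free
      and yields the integer \<open>N\<close>.\<close>
    define b where "b = (\<lambda>j i. \<Sum>k\<le>n. coeff P k * S (k + i) j)"
    define B where "B = Suc e * (Suc n * (H * T))"
    have b_le: "(\<Sum>i<Suc e. \<bar>b (Suc j) i\<bar>) \<le> int B" if "j < e" for j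
    proof -
      have "\<bar>b (Suc j) i\<bar> \<le> int (Suc n * (H * T))" if "i < Suc e" for i
      proof -
        have "\<bar>b (Suc j) i\<bar> \<le> (\<Sum>k\<le>n. \<bar>coeff P k * S (k + i) (Suc j)\<bar>)"
          unfolding b_def by (rule sum_abs)
        also have "\<dots> \<le> (\<Sum>k\<le>n. int (H * T))"
          using \<open>j < e\<close> \<open>i < Suc e\<close> H abs_coeff_le_height[of P] S_le
          by (intro sum_mono) (auto simp: abs_mult D_def intro!: mult_mono)
        finally show ?thesis by (simp add: algebra_simps)
      qed
      then have "(\<Sum>i<Suc e. \<bar>b (Suc j) i\<bar>) \<le> (\<Sum>i<Suc e. int (Suc n * (H * T)))"
        by (intro sum_mono) auto
      then show ?thesis unfolding B_def by (simp add: algebra_simps)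
    qed
    define A where "A = (2 * B + 1) ^ e"
    from siegel_more_unknowns[where M = e and N = "Suc e" and b = "\<lambda>j. b (Suc j)", OF b_le lessI]
    obtain c where c: "\<exists>i<Suc e. c i \<noteq> 0" "\<And>i. i < Suc e \<Longrightarrow> \<bar>c i\<bar> \<le> int A"
      "\<And>j. j < e \<Longrightarrow> (\<Sum>i<Suc e. c i * b (Suc j) i) = 0"
      unfolding A_def by blast
    obtain R where R: "degree R \<le> e" "\<And>i. coeff R i = (if i \<le> e then c i else 0)"
      using exists_poly_with_coeffs by blast
    have "R \<noteq> 0" using c(1) R(2) by (metis coeff_0 less_Suc_eq_le)
    then have R0: "poly (map_poly of_int R) \<zeta> \<noteq> 0" using min R by blast
    have Rsum: "poly (map_poly of_int R) \<zeta> = (\<Sum>i\<le>e. of_int (c i) * \<zeta> ^ i)"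
      unfolding poly_of_int_eq_sum[OF R(1)] using R(2) by simp
    let ?p = "poly (map_poly of_int P) \<zeta>" and ?r = "poly (map_poly of_int R) \<zeta>"
    define N where "N = (\<Sum>i\<le>e. c i * b 0 i)"
    have "of_int q ^ D * (?p * ?r)
        = (\<Sum>k\<le>n. \<Sum>i\<le>e. of_int (c i) * of_int (coeff P k) * (of_int q ^ D * \<zeta> ^ (k + i)))"
      unfolding Rsum poly_of_int_eq_sum[OF P(1)]
      by (simp add: sum_distrib_left sum_distrib_right power_add algebra_simps)
    also have "\<dots> = (\<Sum>i\<le>e. \<Sum>k\<le>n. of_int (c i) * of_int (coeff P k) * (of_int q ^ D * \<zeta> ^ (k + i)))"
      by (rule sum.swap)
    also have "\<dots> = (\<Sum>i\<le>e. \<Sum>k\<le>n. \<Sum>j\<le>e. of_int (c i) * of_int (coeff P k) * of_int (S (k + i) j) * \<zeta> ^ j)"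
    proof (intro sum.cong refl)
      fix i k assume "i \<in> {..e}" "k \<in> {..n}"
      then have "k + i \<le> D" unfolding D_def by simp
      then show "of_int (c i) * of_int (coeff P k) * (of_int q ^ D * \<zeta> ^ (k + i))
          = (\<Sum>j\<le>e. of_int (c i) * of_int (coeff P k) * of_int (S (k + i) j) * \<zeta> ^ j)"
        by (simp only: S sum_distrib_left mult.assoc)
    qed
    also have "\<dots> = (\<Sum>i\<le>e. \<Sum>j\<le>e. \<Sum>k\<le>n. of_int (c i) * of_int (coeff P k) * of_int (S (k + i) j) * \<zeta> ^ j)"
      by (intro sum.cong refl sum.swap)
    also have "\<dots> = (\<Sum>i\<le>e. \<Sum>j\<le>e. of_int (c i * b j i) * \<zeta> ^ j)"
      unfolding b_def by (simp add: sum_distrib_left sum_distrib_right algebra_simps)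
    also have "\<dots> = (\<Sum>j\<le>e. \<Sum>i\<le>e. of_int (c i * b j i) * \<zeta> ^ j)"
      by (rule sum.swap)
    also have "\<dots> = (\<Sum>j\<le>e. of_int (\<Sum>i\<le>e. c i * b j i) * \<zeta> ^ j)"
      by (simp add: sum_distrib_right)
    also have "\<dots> = of_int N"
    proof -
      have "(\<Sum>i\<le>e. c i * b j i) = 0" if "j \<in> {..e} - {0}" for j
        using that c(3)[of "j - 1"] by (auto simp: lessThan_Suc_atMost)
      then show ?thesis unfolding N_def by (subst sum.remove[of _ 0]) auto
    qed
    finally have N: "of_int q ^ D * (?p * ?r) = of_int N" .
    then have "N \<noteq> 0" using q0 P(2) R0 by (metis mult_eq_0_iff of_int_0 of_int_0_eq_iff power_not_zero)
    then have "1 \<le> \<bar>real_of_int N\<bar>" by linarith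
    also have "\<dots> = \<bar>real_of_int q\<bar> ^ D * (\<bar>?p\<bar> * \<bar>?r\<bar>)"
      unfolding N[symmetric] by (simp add: abs_mult power_abs)
    also have "\<dots> \<le> \<bar>real_of_int q\<bar> ^ D * (\<bar>?p\<bar> * ((real c1 ^ e * real H ^ e) * Z))"
    proof -
      have "B = t * H" unfolding B_def t_def by (simp add: algebra_simps)
      then have "2 * B + 1 \<le> c1 * H" using H(2) unfolding c1_def by simp
      then have "A \<le> (c1 * H) ^ e" unfolding A_def by (intro power_mono) auto
      then have A: "real A \<le> real c1 ^ e * real H ^ e"
        by (metis of_nat_le_iff of_nat_mult of_nat_power power_mult_distrib)
      have "\<bar>?r\<bar> \<le> (\<Sum>i\<le>e. \<bar>real_of_int (c i)\<bar> * \<bar>\<zeta>\<bar> ^ i)"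
        unfolding Rsum by (rule order_trans[OF sum_abs]) (simp add: abs_mult power_abs)
      also have "\<dots> \<le> (\<Sum>i\<le>e. real A * \<bar>\<zeta>\<bar> ^ i)"
      proof (intro sum_mono mult_right_mono)
        fix i assume "i \<in> {..e}"
        then show "\<bar>real_of_int (c i)\<bar> \<le> real A" using c(2)[of i] by simp
      qed auto
      also have "\<dots> \<le> (real c1 ^ e * real H ^ e) * Z"
        unfolding Z_def sum_distrib_left[symmetric] using A by (intro mult_right_mono sum_nonneg) auto
      finally show ?thesis by (intro mult_left_mono) auto
    qed
    also have "\<dots> = C * real_of_int (poly_height P) ^ e * \<bar>?p\<bar>"
      unfolding C_def H(1)[symmetric] by simp
    finally show "1 \<le> C * real_of_int (poly_height P) ^ e * \<bar>?p\<bar>" .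
  qed (rule C)
qed

text \<open>For algebraic \<open>\<zeta>\<close>, an approximant of exponent \<open>e + 1\<close>
  and height \<open>H\<close> would satisfy \<open>1 \<le> C / H\<close> by Liouville's inequality,
  which bounds \<open>H\<close>.\<close>

lemma transcendental_if_w_infinite:
  assumes "w_exponent n \<zeta> = \<infinity>" "Q \<noteq> 0"
  shows "poly (map_poly of_int Q) \<zeta> \<noteq> 0"
proof
  assume "poly (map_poly of_int Q) \<zeta> = 0"
  from liouville_inequality[OF assms(2) this, of n] obtain C e where C: "C > 0"
    "\<And>P. degree P \<le> n \<Longrightarrow> poly (map_poly of_int P) \<zeta> \<noteq> 0 \<Longrightarrow>
       1 \<le> C * real_of_int (poly_height P) ^ e * \<bar>poly (map_poly of_int P) \<zeta>\<bar>" by metis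
  have "infinite (w_approximants n \<zeta> (real e + 1))"
    using assms(1) by (intro infinite_approximants_if_less_w) auto
  from w_approximants_unbounded[OF this, of "C + 1"] obtain P where
    P: "P \<in> w_approximants n \<zeta> (real e + 1)" "real_of_int (poly_height P) \<ge> C + 1" by blast
  let ?h = "real_of_int (poly_height P)"
  have h: "?h > 0" using P C by linarith
  have "1 \<le> C * ?h ^ e * \<bar>poly (map_poly of_int P) \<zeta>\<bar>"
    using P(1) by (intro C) (auto simp: w_approximants_def)
  also have "\<dots> \<le> C * ?h ^ e * ?h powr (- (real e + 1))"
    using P C h by (intro mult_left_mono) (auto simp: w_approximants_def)
  also have "?h powr (- (real e + 1)) = inverse (?h ^ e * ?h)"
    using h by (simp only: powr_minus powr_add powr_realpow powr_one) 
  also have "C * ?h ^ e * inverse (?h ^ e * ?h) = C / ?h" using h by (simp add: field_simps)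
  also have "\<dots> < 1" using P(2) h by simp
  finally show False by simp
qed

section \<open>Transference between polynomial and simultaneous approximation\<close>

definition lambda_uniform :: "nat \<Rightarrow> nat \<Rightarrow> real \<Rightarrow> real \<Rightarrow> bool" where
  "lambda_uniform n j \<zeta> l \<longleftrightarrow> (\<exists>X\<^sub>0. \<forall>X\<ge>X\<^sub>0. lambda_solvable n j \<zeta> l X)"

lemma lambda_uniform_imp_admissible: "lambda_uniform n j \<zeta> l \<Longrightarrow> lambda_admissible n j \<zeta> l"
  unfolding lambda_uniform_def lambda_admissible_def by (metis linorder_linear max.cobounded1 max.cobounded2)

text \<open>Entry 0 is written with \<open>\<zeta> ^ 0\<close> so that one formula in
  \<open>i\<close> defines the whole integer vector; its entry 0 is simply
  \<open>x - y\<close>.\<close>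

lemma floor_difference_error:
  "\<zeta> ^ i * real_of_int (\<lfloor>\<zeta> ^ 0 * real x\<rfloor> - \<lfloor>\<zeta> ^ 0 * real y\<rfloor>) - real_of_int (\<lfloor>\<zeta> ^ i * real x\<rfloor> - \<lfloor>\<zeta> ^ i * real y\<rfloor>)
     = frac (\<zeta> ^ i * real x) - frac (\<zeta> ^ i * real y)"
  by (simp add: frac_def algebra_simps)

lemma powr_inverse_power:
  assumes "x > 0" "n \<ge> 1"
  shows "(x powr (1 / real n)) ^ n = x"
proof -
  have "(x powr (1 / real n)) ^ n = (x powr (1 / real n)) powr real n"
    using assms by (intro powr_realpow[symmetric]) simp
  also have "\<dots> = x" using assms by (simp add: powr_powr)
  finally show ?thesis .
qed

text \<open>Rounding \<open>X powr (1 / n)\<close> down to the integer \<open>Q\<close> costs a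
  factor 2, which the strict inequality \<open>l < 1 / n\<close> absorbs.\<close>

lemma dirichlet_uniform:
  assumes "n \<ge> 1" "l < 1 / real n"
  shows "lambda_uniform n 1 \<zeta> l"
proof -
  from assms(2) have "1 / real n - l > 0" by simp
  from const_le_powr[OF this, of 2] obtain X0 where
    X0: "X0 \<ge> 1" "\<And>X. X \<ge> X0 \<Longrightarrow> 2 \<le> X powr (1 / real n - l)" by metis
  have "\<exists>u. simult_approx n \<zeta> l X u" if X: "X \<ge> X0" for X
  proof -
    have X1: "X \<ge> 1" using X X0 by simp
    define Q where "Q = nat \<lfloor>X powr (1 / real n)\<rfloor>"
    define M where "M = nat \<lfloor>X\<rfloor> + 1"
    have r1: "X powr (1 / real n) \<ge> 1" using X1 by (intro ge_one_powr_ge_zero) auto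
    then have Q1: "Q \<ge> 1" and Qle: "real Q \<le> X powr (1 / real n)"
      and "X powr (1 / real n) \<le> real Q + 1"
      unfolding Q_def by linarith+
    then have Qge: "X powr (1 / real n) \<le> 2 * real Q" by simp
    have "real Q ^ n \<le> (X powr (1 / real n)) ^ n" using Qle by (intro power_mono) auto
    also have "\<dots> = X" using X1 assms(1) by (simp add: powr_inverse_power)
    finally have "real (Q ^ n) \<le> X" by simp
    then have "real (Q ^ n) < real M" using X1 unfolding M_def by linarith
    then have "1 * (Q ^ card {1..n} * card {()}) < M" by simp
    from many_close_multiples[OF _ _ _ Q1 this, where g = "\<lambda>_. ()" and \<theta> = "\<lambda>i. \<zeta> ^ i"]
    obtain S where S: "S \<subseteq> {..<M}" "card S > 1"
      "\<And>x y i. x \<in> S \<Longrightarrow> y \<in> S \<Longrightarrow> i \<in> {1..n} \<Longrightarrow> \<bar>frac (\<zeta> ^ i * real x) - frac (\<zeta> ^ i * real y)\<bar> \<le> 1 / real Q"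
      by auto
    from S(2) obtain x y where xy: "x \<in> S" "y \<in> S" "x \<noteq> y"
      by (metis One_nat_def card_1_singletonE card_le_Suc0_iff_eq card.infinite leD less_imp_le zero_less_one not_less)
    define u where "u = (\<lambda>i. \<lfloor>\<zeta> ^ i * real x\<rfloor> - \<lfloor>\<zeta> ^ i * real y\<rfloor>)"
    have "\<bar>u 0\<bar> \<ge> 1" using xy unfolding u_def by simp
    moreover have "real_of_int \<bar>u 0\<bar> \<le> X"
    proof -
      have "x \<le> nat \<lfloor>X\<rfloor>" "y \<le> nat \<lfloor>X\<rfloor>" using xy S(1) unfolding M_def by auto
      then show ?thesis using X1 unfolding u_def by simp linarith
    qed
    moreover have "\<bar>\<zeta> ^ i * real_of_int (u 0) - real_of_int (u i)\<bar> \<le> X powr (- l)" if "i \<in> {1..n}" for i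
    proof -
      have "\<bar>\<zeta> ^ i * real_of_int (u 0) - real_of_int (u i)\<bar> \<le> 1 / real Q"
        unfolding u_def floor_difference_error using S(3) xy that by blast
      also have "\<dots> \<le> 2 / X powr (1 / real n)"
        using frac_le[of 2 2 "X powr (1 / real n)" "2 * real Q"] Qge r1 X1 by simp
      also have "\<dots> \<le> X powr (1 / real n - l) / X powr (1 / real n)"
        using X0(2)[OF X] by (intro divide_right_mono) auto
      also have "\<dots> = X powr (- l)" using X1 by (simp add: powr_diff powr_minus field_simps)
      finally show ?thesis .
    qed
    ultimately show ?thesis unfolding simult_approx_def by blast
  qed
  then show ?thesis unfolding lambda_uniform_def lambda_solvable_1_iff by blast
qed

lemma lambda_exponent_ge_inverse:
  assumes "n \<ge> 1"
  shows "ereal (1 / real n) \<le> lambda_exponent n 1 \<zeta>"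
  by (rule ereal_le_if_reals_below)
    (use assms dirichlet_uniform lambda_uniform_imp_admissible lambda_exponent_ge in force)

text \<open>Forces denominators to grow: only finitely many nonzero \<open>x\<close> are bounded by
  \<open>B\<close>, so an approximation with small enough error must have
  \<open>\<bar>x\<bar> > B\<close>.\<close>

lemma multiples_bounded_away_from_int:
  fixes \<zeta> :: real
  assumes "\<And>x y :: int. x \<noteq> 0 \<Longrightarrow> \<zeta> * of_int x \<noteq> of_int y"
  obtains \<eta> where "\<eta> > 0" "\<And>x y :: int. x \<noteq> 0 \<Longrightarrow> \<bar>x\<bar> \<le> B \<Longrightarrow> \<bar>\<zeta> * of_int x - of_int y\<bar> \<ge> \<eta>"
proof -
  \<comment> \<open>The element 1 keeps the set nonempty when \<open>B < 1\<close>.\<close>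
  define T where "T = insert 1 ((\<lambda>x. \<bar>\<zeta> * of_int x - of_int (round (\<zeta> * of_int x))\<bar>) ` ({-B..B} - {0}))"
  show ?thesis
  proof (rule that[of "Min T"])
    show "Min T > 0" unfolding T_def using assms by (subst Min_gr_iff) auto
    fix x y :: int assume x: "x \<noteq> 0" "\<bar>x\<bar> \<le> B"
    have "Min T \<le> \<bar>\<zeta> * of_int x - of_int (round (\<zeta> * of_int x))\<bar>"
    proof -
      have "x \<in> {-B..B} - {0}" using x by auto
      then show ?thesis unfolding T_def by (intro Min_le insertI2 imageI) auto
    qed
    also have "\<dots> \<le> \<bar>\<zeta> * of_int x - of_int y\<bar>"
      using round_diff_minimal[of "\<zeta> * of_int x" y] by (simp add: abs_minus_commute)
    finally show "Min T \<le> \<bar>\<zeta> * of_int x - of_int y\<bar>" .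
  qed
qed

text \<open>A finite set of approximants has a smallest nonzero absolute value at
  \<open>\<zeta>\<close>. Exhibiting ever smaller values is easier than exhibiting distinct
  polynomials.\<close>

lemma infinite_approximants_if_small_values:
  assumes "\<And>\<eta>. \<eta> > 0 \<Longrightarrow> \<exists>P\<in>w_approximants n \<zeta> w. \<bar>poly (map_poly of_int P) \<zeta>\<bar> < \<eta>"
  shows "infinite (w_approximants n \<zeta> w)"
proof
  assume fin: "finite (w_approximants n \<zeta> w)"
  let ?T = "insert 1 ((\<lambda>P. \<bar>poly (map_poly of_int P) \<zeta>\<bar>) ` w_approximants n \<zeta> w)"
  have "Min ?T > 0" using fin by (subst Min_gr_iff) (auto simp: w_approximants_def)
  from assms[OF this] obtain P where "P \<in> w_approximants n \<zeta> w"
    "\<bar>poly (map_poly of_int P) \<zeta>\<bar> < Min ?T" by blast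
  with fin show False by (meson Min_le finite_imageI finite_insert image_eqI insertCI not_le)
qed

lemma transcendental_not_rational:
  assumes "\<And>Q. Q \<noteq> 0 \<Longrightarrow> poly (map_poly of_int Q) \<zeta> \<noteq> (0::real)" and "x \<noteq> (0::int)"
  shows "\<zeta> * of_int x \<noteq> of_int y"
proof -
  have "poly (map_poly of_int [:-y, x:]) \<zeta> \<noteq> (0::real)" using assms by (intro assms(1)) auto
  then show ?thesis by (auto simp: map_poly_pCons algebra_simps)
qed

text \<open>If \<open>u\<close> is a good simultaneous approximation, Siegel's lemma gives a polynomial of small
  height orthogonal to \<open>u\<close>, and such a polynomial takes a small value at \<open>\<zeta>\<close>.\<close>

lemma infinite_approximants_if_lambda_admissible:
  fixes \<zeta> :: real
  assumes trans: "\<And>Q. Q \<noteq> 0 \<Longrightarrow> poly (map_poly of_int Q) \<zeta> \<noteq> 0"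
    and n: "n \<ge> 1" and l: "l > 0" and adm: "lambda_admissible n 1 \<zeta> l"
    and w: "0 \<le> w" "w < real n * l + real n - 1"
  shows "infinite (w_approximants n \<zeta> w)"
proof (rule infinite_approximants_if_small_values)
  fix \<eta> :: real assume \<eta>: "\<eta> > 0"
  define Z where "Z = max 1 \<bar>\<zeta>\<bar> ^ n"
  have Z1: "Z \<ge> 1" unfolding Z_def by simp
  have Zge: "\<bar>\<zeta>\<bar> ^ i \<le> Z" if "i \<le> n" for i
    unfolding Z_def using that by (rule abs_power_le_max_power)
  \<comment> \<open>Makes twice the sum of the \<open>\<bar>u i\<bar>\<close> at most
    \<open>c * x\<close>; Siegel's lemma for one equation in \<open>n + 1\<close> unknowns then
    works with \<open>A\<close> of order \<open>(c * x) powr (1 / n)\<close>.\<close>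
  define c where "c = 2 * (real n + 1) * (Z + 1)"
  have c1: "c \<ge> 1" unfolding c_def using Z1 mult_mono[of 1 "2 * (real n + 1)" 1 "Z + 1"] by simp
  define C where "C = c powr (1 / real n)"
  have C1: "C \<ge> 1" unfolding C_def using c1 by (intro ge_one_powr_ge_zero) auto
  \<comment> \<open>The orthogonal polynomial will satisfy
    \<open>\<bar>P(\<zeta>)\<bar> * x \<le> n * A * x powr - l\<close> with
    \<open>A \<le> C * x powr (1 / n)\<close>. The goal
    \<open>\<bar>P(\<zeta>)\<bar> \<le> A powr - w\<close> then reduces to this gap in the exponent
    of \<open>x\<close>.\<close>
  have "(w + 1) / real n < 1 + l" using w n by (simp add: field_simps)
  then have e: "1 + l - (w + 1) / real n > 0" by simp
  from const_le_powr[OF e, of "real n * C powr (w + 1)"] obtain B1 where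
    B1: "B1 \<ge> 1" "\<And>x. x \<ge> B1 \<Longrightarrow> real n * C powr (w + 1) \<le> x powr (1 + l - (w + 1) / real n)" by metis
  from const_le_powr[OF l, of "(real n * C + 1) / \<eta>"] obtain B2 where
    B2: "B2 \<ge> 1" "\<And>x. x \<ge> B2 \<Longrightarrow> (real n * C + 1) / \<eta> \<le> x powr l" by metis
  \<comment> \<open>The thresholds concern the denominator \<open>x = \<bar>u 0\<bar>\<close>,
    whereas admissibility only makes \<open>X\<close> large; irrationality of \<open>\<zeta>\<close>
    transfers largeness from \<open>X\<close> to \<open>x\<close>.\<close>
  define B where "B = \<lceil>max B1 B2\<rceil>"
  from multiples_bounded_away_from_int[OF transcendental_not_rational[OF trans], of B]
  obtain \<delta> where \<delta>: "\<delta> > 0" "\<And>x y :: int. x \<noteq> 0 \<Longrightarrow> \<bar>x\<bar> \<le> B \<Longrightarrow> \<bar>\<zeta> * of_int x - of_int y\<bar> \<ge> \<delta>" by metis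
  from const_le_powr[OF l, of "1 / \<delta> + 1"] obtain B3 where
    B3: "B3 \<ge> 1" "\<And>x. x \<ge> B3 \<Longrightarrow> 1 / \<delta> + 1 \<le> x powr l" by metis
  from adm obtain X u where X: "X \<ge> B3" and u: "simult_approx n \<zeta> l X u"
    unfolding lambda_admissible_def lambda_solvable_1_iff by blast
  have X1: "X \<ge> 1" using X B3 by simp
  define x where "x = real_of_int \<bar>u 0\<bar>"
  have u0: "u 0 \<noteq> 0" and xX: "x \<le> X" and x1: "x \<ge> 1"
    using u unfolding simult_approx_def x_def by auto
  have err: "\<bar>\<zeta> ^ i * real_of_int (u 0) - real_of_int (u i)\<bar> \<le> X powr - l" if "i \<le> n" for i
    using u that unfolding simult_approx_def by (cases "i = 0") auto
  have "X powr - l < \<delta>"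
  proof -
    have "1 / \<delta> < X powr l" using B3(2)[OF X] by simp
    then show ?thesis using \<delta>(1) X1 by (simp add: powr_minus field_simps)
  qed
  then have "\<not> \<bar>u 0\<bar> \<le> B" using \<delta>(2)[OF u0, of "u 1"] err[of 1] n by auto
  then have xB: "x \<ge> B1" "x \<ge> B2" unfolding x_def B_def by linarith+
  have err': "\<bar>\<zeta> ^ i * real_of_int (u 0) - real_of_int (u i)\<bar> \<le> x powr - l" if "i \<le> n" for i
  proof -
    have "X powr - l \<le> x powr - l" using xX x1 l by (intro powr_mono2') auto
    with err[OF that] show ?thesis by linarith
  qed
  have xl1: "x powr - l \<le> 1" using x1 l powr_mono[of "- l" 0 x] by simp
  define T where "T = nat (\<Sum>i<Suc n. \<bar>u i\<bar>)"
  have T: "int T = (\<Sum>i<Suc n. \<bar>u i\<bar>)" unfolding T_def by (simp add: sum_nonneg)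
  have "real T \<le> (real n + 1) * ((Z + 1) * x)"
  proof -
    have "\<bar>real_of_int (u i)\<bar> \<le> (Z + 1) * x" if "i \<le> n" for i
    proof -
      have "\<bar>real_of_int (u i)\<bar> \<le> \<bar>\<zeta> ^ i * real_of_int (u 0)\<bar> + 1" using err'[OF that] xl1 by linarith
      also have "\<dots> \<le> Z * x + x"
        using Zge[OF that] x1 by (intro add_mono) (auto simp: abs_mult power_abs x_def intro!: mult_right_mono)
      finally show ?thesis by (simp add: algebra_simps)
    qed
    then have "(\<Sum>i<Suc n. \<bar>real_of_int (u i)\<bar>) \<le> (\<Sum>i<Suc n. (Z + 1) * x)" by (intro sum_mono) auto
    moreover have "real T = (\<Sum>i<Suc n. \<bar>real_of_int (u i)\<bar>)"
      using arg_cong[OF T, of real_of_int] by simp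
    ultimately show ?thesis by (simp add: algebra_simps)
  qed
  then have T_le: "2 * real T \<le> c * x" unfolding c_def by (simp add: algebra_simps)
  have T1: "T \<ge> 1"
  proof -
    have "\<bar>u 0\<bar> \<le> (\<Sum>i<Suc n. \<bar>u i\<bar>)" by (rule member_le_sum) auto
    with u0 T show ?thesis by linarith
  qed
  define A where "A = nat \<lfloor>(c * x) powr (1 / real n)\<rfloor>"
  have cx: "c * x \<ge> 1" using c1 x1 by (metis mult_mono mult_1 order_trans zero_le_one)
  have r1: "(c * x) powr (1 / real n) \<ge> 1" using cx by (intro ge_one_powr_ge_zero) auto
  have A1: "A \<ge> 1" and A_le: "real A \<le> (c * x) powr (1 / real n)"
    and A_ge: "(c * x) powr (1 / real n) < real A + 1"
    using r1 unfolding A_def by linarith+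
  have A_le': "real A \<le> C * x powr (1 / real n)"
    using A_le c1 x1 unfolding C_def by (simp add: powr_mult)
  have "c * x = ((c * x) powr (1 / real n)) ^ n"
    using cx n powr_inverse_power[of "c * x" n] by simp
  also have "\<dots> < (real A + 1) ^ n" using A_ge n by (intro power_strict_mono) auto
  finally have "2 * real T < (real A + 1) ^ n" using T_le by linarith
  then have "real (2 * T) < real ((A + 1) ^ n)" by (simp add: algebra_simps)
  then have "2 * T < (A + 1) ^ n" by (simp only: of_nat_less_iff)
  then have *: "(A + 1) * (2 * T + 1) \<le> (A + 1) * (A + 1) ^ n" by (intro mult_left_mono) auto
  have "2 * A * T + 1 < (A + 1) * (2 * T + 1)" using T1 A1 by (simp add: algebra_simps)
  also note *
  finally have "(2 * A * T + 1) ^ 1 < (A + 1) ^ Suc n" by (simp only: power_one_right power_Suc)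
  from siegel[where M = 1 and N = "Suc n" and b = "\<lambda>_. u" and B = T and A = A, OF eq_refl[OF T[symmetric]] this]
  obtain a where a: "\<exists>i<Suc n. a i \<noteq> 0" "\<And>i. i < Suc n \<Longrightarrow> \<bar>a i\<bar> \<le> int A"
      "(\<Sum>i<Suc n. a i * u i) = 0"
    by (simp del: sum.lessThan_Suc) blast
  obtain P where P: "degree P \<le> n" "\<And>i. coeff P i = (if i \<le> n then a i else 0)"
    using exists_poly_with_coeffs by blast
  have P0: "P \<noteq> 0" using a(1) P(2) by (metis coeff_0 less_Suc_eq_le)
  let ?p = "poly (map_poly of_int P) \<zeta>"
  have p0: "?p \<noteq> 0" using trans[OF P0] .
  have H: "poly_height P \<le> int A" using a(2) P(2) by (intro height_le) auto
  have H1: "poly_height P \<ge> 1" using height_ge_1[OF P0] .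
  have "?p * of_int (u 0) = (\<Sum>i\<le>n. of_int (a i) * (\<zeta> ^ i * of_int (u 0))) - of_int (\<Sum>i<Suc n. a i * u i)"
    unfolding poly_of_int_eq_sum[OF P(1)] a(3) using P(2) by (simp add: sum_distrib_right mult.assoc)
  also have "\<dots> = (\<Sum>i\<le>n. of_int (a i) * (\<zeta> ^ i * of_int (u 0) - of_int (u i)))"
    by (simp add: right_diff_distrib sum_subtractf lessThan_Suc_atMost del: sum.lessThan_Suc)
  also have "\<dots> = (\<Sum>i=1..n. of_int (a i) * (\<zeta> ^ i * of_int (u 0) - of_int (u i)))"
    by (intro sum.mono_neutral_right) (auto simp: not_le)
  finally have "\<bar>?p\<bar> * x = \<bar>\<Sum>i=1..n. of_int (a i) * (\<zeta> ^ i * of_int (u 0) - of_int (u i))\<bar>"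
    unfolding x_def by (metis abs_mult of_int_abs)
  also have "\<dots> \<le> (\<Sum>i=1..n. \<bar>of_int (a i)\<bar> * \<bar>\<zeta> ^ i * of_int (u 0) - of_int (u i)\<bar>)"
    by (rule order_trans[OF sum_abs]) (simp add: abs_mult)
  also have "\<dots> \<le> (\<Sum>i=1..n. real A * x powr - l)"
  proof (intro sum_mono mult_mono)
    fix i assume "i \<in> {1..n}"
    then show "\<bar>real_of_int (a i)\<bar> \<le> real A" using a(2)[of i] by simp
  qed (use err' in auto)
  finally have p_le: "\<bar>?p\<bar> * x \<le> real n * real A * x powr - l" by simp
  have "\<bar>?p\<bar> \<le> real A powr - w"
  proof -
    have "real n * real A powr (w + 1) \<le> real n * (C * x powr (1 / real n)) powr (w + 1)"
      using A_le' w by (intro mult_left_mono powr_mono2) auto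
    also have "\<dots> = real n * C powr (w + 1) * x powr ((w + 1) / real n)"
      using C1 x1 by (simp add: powr_mult powr_powr)
    also have "\<dots> \<le> x powr (1 + l - (w + 1) / real n) * x powr ((w + 1) / real n)"
      using B1(2)[OF xB(1)] by (intro mult_right_mono) auto
    also have "\<dots> = x powr (1 + l)" by (simp add: powr_add[symmetric])
    also have "\<dots> = x * x powr l" using x1 by (simp add: powr_add)
    finally have *: "real n * (real A * real A powr w) \<le> x * x powr l"
      using A1 by (simp add: powr_add mult.commute)
    have "\<bar>?p\<bar> * x * (x powr l * real A powr w) \<le> real n * real A * x powr - l * (x powr l * real A powr w)"
      using p_le by (intro mult_right_mono) auto
    also have "\<dots> = real n * (real A * real A powr w)" using x1 by (simp add: powr_minus)
    also note *
    finally have "(\<bar>?p\<bar> * real A powr w) * (x * x powr l) \<le> 1 * (x * x powr l)" by (simp add: algebra_simps)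
    then have "\<bar>?p\<bar> * real A powr w \<le> 1" using x1 by (subst (asm) mult_le_cancel_right) auto
    then show ?thesis using A1 by (simp add: powr_minus field_simps)
  qed
  also have "\<dots> \<le> real_of_int (poly_height P) powr - w"
    using H H1 w(1) by (intro powr_mono2') auto
  finally have "P \<in> w_approximants n \<zeta> w"
    unfolding w_approximants_def using P p0 by auto
  moreover have "\<bar>?p\<bar> < \<eta>"
  proof -
    have "x powr (1 / real n) \<le> x powr 1" using x1 n by (intro powr_mono) auto
    then have "C * x powr (1 / real n) \<le> C * x" using C1 x1 by (intro mult_left_mono) auto
    then have "real A \<le> C * x" using A_le' by linarith
    then have "real n * real A * x powr - l \<le> real n * (C * x) * x powr - l"
      by (intro mult_right_mono mult_left_mono) auto
    with p_le have "\<bar>?p\<bar> * x \<le> (real n * C * x powr - l) * x" by (simp add: algebra_simps)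
    then have "\<bar>?p\<bar> \<le> real n * C * x powr - l" using x1 by (subst (asm) mult_le_cancel_right) auto
    also have "\<dots> < \<eta>"
    proof -
      have "(real n * C + 1) \<le> x powr l * \<eta>" using B2(2)[OF xB(2)] \<eta> by (simp add: field_simps)
      then have "real n * C < x powr l * \<eta>" by simp
      then show ?thesis using x1 by (simp add: powr_minus field_simps)
    qed
    finally show ?thesis .
  qed
  ultimately show "\<exists>P\<in>w_approximants n \<zeta> w. \<bar>poly (map_poly of_int P) \<zeta>\<bar> < \<eta>" by blast
qed

text \<open>If all nonconstant coefficients were small, the constant one would carry the height and
  could not be cancelled down to a value of at most 1. A positive index is required because the
  transference solves for entry \<open>k\<close> of an integer vector, and entry 0 is its
  denominator.\<close>

lemma large_nonconstant_coeff:
  fixes \<zeta> :: real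
  assumes n: "n \<ge> 1" and deg: "degree P \<le> n" and small: "\<bar>poly (map_poly of_int P) \<zeta>\<bar> \<le> 1"
    and H: "real_of_int (poly_height P) \<ge> 3"
  obtains k where "k \<in> {1..n}"
    "real_of_int (poly_height P) \<le> 2 * real n * max 1 \<bar>\<zeta>\<bar> ^ n * \<bar>real_of_int (coeff P k)\<bar>"
proof -
  let ?H = "real_of_int (poly_height P)" and ?Z = "max 1 \<bar>\<zeta>\<bar> ^ n"
  have Z: "?Z \<ge> 1" by simp
  have "\<exists>k\<in>{1..n}. ?H \<le> 2 * real n * ?Z * \<bar>real_of_int (coeff P k)\<bar>"
  proof (rule ccontr)
    assume "\<not> ?thesis"
    then have less: "2 * real n * ?Z * \<bar>real_of_int (coeff P k)\<bar> < ?H" if "k \<in> {1..n}" for k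
      using that by (meson not_le)
    obtain k where k: "k \<le> degree P" "\<bar>coeff P k\<bar> = poly_height P" using height_attained by blast
    show False
    proof (cases "k = 0")
      case False
      have "1 * 1 \<le> (2 * real n) * ?Z" using n Z by (intro mult_mono) auto
      then have "1 * ?H \<le> (2 * real n * ?Z) * ?H" using H by (intro mult_right_mono) auto
      moreover have "\<bar>real_of_int (coeff P k)\<bar> = ?H" using k(2) by (metis of_int_abs)
      then have "2 * real n * ?Z * ?H < ?H" using less[of k] k(1) False deg by simp
      ultimately show False by linarith
    next
      case True
      have "(\<Sum>i=1..n. \<bar>of_int (coeff P i) * \<zeta> ^ i\<bar>) \<le> (\<Sum>i=1..n. ?H / (2 * real n))"
      proof (intro sum_mono)
        fix i assume i: "i \<in> {1..n}"
        have "\<bar>of_int (coeff P i) * \<zeta> ^ i\<bar> \<le> \<bar>real_of_int (coeff P i)\<bar> * ?Z"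
          using i abs_power_le_max_power[of i n \<zeta>] by (auto simp: abs_mult power_abs intro!: mult_left_mono)
        also have "\<dots> \<le> ?H / (2 * real n)" using less[OF i] n by (simp add: field_simps)
        finally show "\<bar>of_int (coeff P i) * \<zeta> ^ i\<bar> \<le> ?H / (2 * real n)" .
      qed
      also have "\<dots> = ?H / 2" using n by simp
      finally have "\<bar>\<Sum>i=1..n. of_int (coeff P i) * \<zeta> ^ i\<bar> \<le> ?H / 2"
        using sum_abs[of "\<lambda>i. of_int (coeff P i) * \<zeta> ^ i" "{1..n}"] by linarith
      moreover have "poly (map_poly of_int P) \<zeta> = of_int (coeff P 0) + (\<Sum>i=1..n. of_int (coeff P i) * \<zeta> ^ i)"
        unfolding poly_of_int_eq_sum[OF deg] by (subst sum.remove[of _ 0]) (auto intro!: sum.cong)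
      moreover have "\<bar>real_of_int (coeff P 0)\<bar> = ?H" using k True by (metis of_int_abs)
      ultimately have "?H \<le> 1 + ?H / 2" using small by linarith
      with H show False by linarith
    qed
  qed
  then show ?thesis using that by blast
qed

text \<open>The converse transference: a pigeonhole argument modulo one large coefficient \<open>a\<^sub>k\<close> of \<open>P\<close>
  produces an integer vector orthogonal to \<open>P\<close> whose errors at the indices other than \<open>k\<close> are
  small; orthogonality and the smallness of \<open>P(\<zeta>)\<close> then control the error at \<open>k\<close>.\<close>

lemma lambda_admissible_if_infinite_approximants:
  fixes \<zeta> :: real
  assumes n: "n \<ge> 1" and w: "w > 0" and inf: "infinite (w_approximants n \<zeta> w)"
    and l: "l < w / (real n + (real n - 1) * w)"
  shows "lambda_admissible n 1 \<zeta> l"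
proof -
  define c where "c = 2 * real n * max 1 \<bar>\<zeta>\<bar> ^ n"
  have "1 * 1 \<le> (2 * real n) * max 1 \<bar>\<zeta>\<bar> ^ n" using n by (intro mult_mono) auto
  then have c1: "c \<ge> 1" unfolding c_def by simp
  \<comment> \<open>With \<open>Q\<close> of order \<open>H powr (w / n)\<close> and residues modulo
    a coefficient of size at most \<open>H\<close>, the number of classes is at most
    \<open>Q ^ (n - 1) * H\<close>, hence the scale \<open>X = H powr \<xi>\<close>. The errors have
    order \<open>H powr - (w / n)\<close>, and \<open>w / n / \<xi>\<close> is the bound assumed for
    \<open>l\<close>.\<close>
  define \<xi> where "\<xi> = (real n + (real n - 1) * w) / real n"
  have "real n + (real n - 1) * w \<ge> real n" using n w by simp
  then have \<xi>1: "\<xi> \<ge> 1" unfolding \<xi>_def using n by (simp add: field_simps)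
  have \<xi>w: "\<xi> - w = 1 - w / real n" "\<xi> = 1 + (real n - 1) * (w / real n)"
    unfolding \<xi>_def using n by (simp_all add: field_simps)
  have "l * (real n + (real n - 1) * w) < w"
    using l \<open>real n + (real n - 1) * w \<ge> real n\<close> n by (simp add: field_simps)
  then have "w / real n - \<xi> * l > 0" unfolding \<xi>_def using n by (simp add: field_simps)
  from const_le_powr[OF this, of "(2 * real n + 1) * c"] obtain B1 where
    B1: "B1 \<ge> 1" "\<And>H. H \<ge> B1 \<Longrightarrow> (2 * real n + 1) * c \<le> H powr (w / real n - \<xi> * l)" by metis
  have "\<exists>X\<ge>X0. \<exists>u. simult_approx n \<zeta> l X u" for X0
  proof -
    from w_approximants_unbounded[OF inf, of "max (max B1 3) X0"] obtain P where
      P: "P \<in> w_approximants n \<zeta> w" and big: "real_of_int (poly_height P) \<ge> max (max B1 3) X0" by blast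
    define H where "H = real_of_int (poly_height P)"
    have H: "H \<ge> B1" "H \<ge> 3" "H \<ge> X0" using big unfolding H_def by auto
    let ?p = "poly (map_poly of_int P) \<zeta>"
    have deg: "degree P \<le> n" and p_le: "\<bar>?p\<bar> \<le> H powr - w"
      using P unfolding w_approximants_def H_def by auto
    have "H powr - w \<le> 1" using powr_mono[of "- w" 0 H] H w by simp
    with p_le have "\<bar>?p\<bar> \<le> 1" by linarith
    from large_nonconstant_coeff[OF n deg this] H(2) obtain k where k: "k \<in> {1..n}"
      "H \<le> c * \<bar>real_of_int (coeff P k)\<bar>" unfolding H_def c_def by metis
    define a where "a = coeff P"
    have a_le: "\<bar>real_of_int (a i)\<bar> \<le> H" for i
      unfolding a_def H_def using abs_coeff_le_height[of P i] by linarith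
    have ak0: "a k \<noteq> 0" using k(2) H(2) unfolding a_def by auto
    define X where "X = H powr \<xi>"
    have "H powr 1 \<le> X" unfolding X_def using H \<xi>1 by (intro powr_mono) auto
    then have XH: "X \<ge> H" using H by simp
    define Q where "Q = nat \<lfloor>H powr (w / real n)\<rfloor>"
    have r1: "H powr (w / real n) \<ge> 1" using H w by (intro ge_one_powr_ge_zero) auto
    then have Q1: "Q \<ge> 1" and Qle: "real Q \<le> H powr (w / real n)"
      and "H powr (w / real n) \<le> real Q + 1"
      unfolding Q_def by linarith+
    then have Qge: "H powr (w / real n) \<le> 2 * real Q" by simp
    have Qinv: "1 / real Q \<le> 2 * H powr - (w / real n)"
      using frac_le[of 2 2 "H powr (w / real n)" "2 * real Q"] Qge r1 H by (simp add: powr_minus field_simps)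
    define M where "M = nat \<lfloor>X\<rfloor> + 1"
    \<comment> \<open>Index 0 carries no error and is left out of the cells, but it does enter the
      residue \<open>g\<close> below.\<close>
    define I where "I = {1..n} - {k}"
    have cI: "card I = n - 1" unfolding I_def using k by simp
    have "real Q ^ (n - 1) * \<bar>real_of_int (a k)\<bar> \<le> (H powr (w / real n)) ^ (n - 1) * H"
      using Qle a_le H by (intro mult_mono power_mono) auto
    also have "(H powr (w / real n)) ^ (n - 1) = H powr ((real n - 1) * (w / real n))"
      using H n by (simp add: powr_realpow[symmetric] powr_powr mult.commute of_nat_diff)
    also have "\<dots> * H = X" unfolding X_def \<xi>w(2) using H by (simp add: powr_add)
    finally have "real Q ^ (n - 1) * \<bar>real_of_int (a k)\<bar> \<le> X" .
    also have "X < real M" unfolding M_def using XH H by linarith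
    finally have "real (1 * (Q ^ card I * card {0..<\<bar>a k\<bar>})) < real M" by (simp add: cI)
    then have less: "1 * (Q ^ card I * card {0..<\<bar>a k\<bar>}) < M" by (simp only: of_nat_less_iff)
    \<comment> \<open>Equal residues make the combination of the differences at all indices other
      than \<open>k\<close> divisible by \<open>a k\<close>, so that orthogonality to
      \<open>P\<close> can be solved for entry \<open>k\<close> in integers.\<close>
    define g where "g = (\<lambda>x::nat. (\<Sum>i\<in>{..n} - {k}. a i * \<lfloor>\<zeta> ^ i * real x\<rfloor>) mod \<bar>a k\<bar>)"
    have "g x \<in> {0..<\<bar>a k\<bar>}" for x unfolding g_def using ak0 by simp
    moreover have "finite I" unfolding I_def by simp
    ultimately
    obtain S where S: "S \<subseteq> {..<M}" "card S > 1" "\<And>x y. x \<in> S \<Longrightarrow> y \<in> S \<Longrightarrow> g x = g y"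
      "\<And>x y i. x \<in> S \<Longrightarrow> y \<in> S \<Longrightarrow> i \<in> I \<Longrightarrow> \<bar>frac (\<zeta> ^ i * real x) - frac (\<zeta> ^ i * real y)\<bar> \<le> 1 / real Q"
      using many_close_multiples[where g = g and \<theta> = "\<lambda>i. \<zeta> ^ i", OF _ _ _ Q1 less]
      by (metis finite_atLeastLessThan_int)
    from S(2) obtain x y where xy: "x \<in> S" "y \<in> S" "x \<noteq> y"
      by (metis One_nat_def card_1_singletonE card_le_Suc0_iff_eq card.infinite leD less_imp_le zero_less_one not_less)
    define z where "z = (\<lambda>i. \<lfloor>\<zeta> ^ i * real x\<rfloor> - \<lfloor>\<zeta> ^ i * real y\<rfloor>)"
    have "\<bar>a k\<bar> dvd (\<Sum>i\<in>{..n} - {k}. a i * \<lfloor>\<zeta> ^ i * real x\<rfloor>) - (\<Sum>i\<in>{..n} - {k}. a i * \<lfloor>\<zeta> ^ i * real y\<rfloor>)"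
      using S(3)[OF xy(1,2)] unfolding g_def by (rule mod_eq_dvd_iff[THEN iffD1])
    then have "a k dvd (\<Sum>i\<in>{..n} - {k}. a i * z i)"
      unfolding z_def by (simp add: right_diff_distrib sum_subtractf)
    then obtain y where y: "(\<Sum>i\<in>{..n} - {k}. a i * z i) = a k * y" by auto
    define u where "u = z(k := - y)"
    have orth: "(\<Sum>i\<le>n. a i * u i) = 0"
    proof -
      have "(\<Sum>i\<le>n. a i * u i) = a k * u k + (\<Sum>i\<in>{..n} - {k}. a i * u i)"
        using k by (intro sum.remove) auto
      also have "(\<Sum>i\<in>{..n} - {k}. a i * u i) = (\<Sum>i\<in>{..n} - {k}. a i * z i)"
        by (intro sum.cong) (auto simp: u_def)
      finally show ?thesis unfolding y by (simp add: u_def)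
    qed
    have u0: "u 0 = z 0" using k unfolding u_def by auto
    have u0_1: "\<bar>u 0\<bar> \<ge> 1" unfolding u0 using xy unfolding z_def by simp
    have u0_X: "real_of_int \<bar>u 0\<bar> \<le> X"
    proof -
      have "x \<in> {..<M}" using xy S(1) by auto
      moreover have "\<exists>y'\<in>{..<M}. z 0 = int x - int y'" using xy S(1) unfolding z_def by force
      ultimately show ?thesis using XH H unfolding u0 M_def by auto linarith
    qed
    define err where "err = (\<lambda>i. \<zeta> ^ i * real_of_int (u 0) - real_of_int (u i))"
    have err_I: "\<bar>err i\<bar> \<le> 2 * H powr - (w / real n)" if "i \<in> {..n} - {k}" for i
    proof (cases "i = 0")
      case False
      then have i: "i \<in> I" using that unfolding I_def by auto
      have "err i = \<zeta> ^ i * real_of_int (z 0) - real_of_int (z i)"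
        using that unfolding err_def u0 by (simp add: u_def)
      then have "\<bar>err i\<bar> \<le> 1 / real Q"
        unfolding z_def floor_difference_error using S(4)[OF xy(1,2) i] by simp
      with Qinv show ?thesis by linarith
    qed (simp add: err_def)
    have "?p * of_int (u 0) = (\<Sum>i\<le>n. of_int (a i) * (\<zeta> ^ i * of_int (u 0))) - of_int (\<Sum>i\<le>n. a i * u i)"
      unfolding poly_of_int_eq_sum[OF deg] orth by (simp add: a_def sum_distrib_right mult.assoc)
    also have "\<dots> = (\<Sum>i\<le>n. of_int (a i) * err i)"
      unfolding err_def by (simp add: right_diff_distrib sum_subtractf)
    also have "\<dots> = of_int (a k) * err k + (\<Sum>i\<in>{..n} - {k}. of_int (a i) * err i)"
      using k by (intro sum.remove) auto
    finally have "of_int (a k) * err k = ?p * of_int (u 0) - (\<Sum>i\<in>{..n} - {k}. of_int (a i) * err i)"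
      by simp
    then have "\<bar>real_of_int (a k)\<bar> * \<bar>err k\<bar> \<le> \<bar>?p * of_int (u 0)\<bar> + \<bar>\<Sum>i\<in>{..n} - {k}. of_int (a i) * err i\<bar>"
      by (metis abs_mult abs_triangle_ineq4)
    also have "\<bar>?p * of_int (u 0)\<bar> \<le> H powr - w * X"
      using p_le u0_X by (simp only: abs_mult) (intro mult_mono, auto)
    also have "\<bar>\<Sum>i\<in>{..n} - {k}. of_int (a i) * err i\<bar> \<le> (\<Sum>i\<in>{..n} - {k}. H * (2 * H powr - (w / real n)))"
      using a_le err_I H by (intro order_trans[OF sum_abs] sum_mono) (simp only: abs_mult, intro mult_mono, auto)
    also have "(\<Sum>i\<in>{..n} - {k}. H * (2 * H powr - (w / real n))) = real n * (H * (2 * H powr - (w / real n)))"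
      using k by simp
    \<comment> \<open>The choice of \<open>\<xi>\<close> balances the two contributions: since
      \<open>\<xi> - w = 1 - w / n\<close>, the value of \<open>P\<close> costs no more than the
      errors at the other indices.\<close>
    also have "H powr - w * X = H * H powr - (w / real n)"
    proof -
      have "H powr - w * X = H powr (\<xi> - w)" unfolding X_def by (simp add: powr_add[symmetric])
      also have "\<dots> = H powr (1 + - (w / real n))" unfolding \<xi>w(1) by simp
      also have "\<dots> = H * H powr - (w / real n)" using H by (simp only: powr_add powr_one)
      finally show ?thesis .
    qed
    finally have ak_err: "\<bar>real_of_int (a k)\<bar> * \<bar>err k\<bar> \<le> H * ((2 * real n + 1) * H powr - (w / real n))"
      by (simp add: algebra_simps)
    have "H * \<bar>err k\<bar> \<le> c * \<bar>real_of_int (a k)\<bar> * \<bar>err k\<bar>"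
      using k(2) unfolding a_def by (intro mult_right_mono) auto
    also have "\<dots> \<le> c * (H * ((2 * real n + 1) * H powr - (w / real n)))"
      using ak_err c1 unfolding mult.assoc by (intro mult_left_mono) auto
    finally have "H * \<bar>err k\<bar> \<le> H * ((2 * real n + 1) * c * H powr - (w / real n))"
      by (simp add: algebra_simps)
    then have err_k: "\<bar>err k\<bar> \<le> (2 * real n + 1) * c * H powr - (w / real n)"
      using H by (subst (asm) mult_le_cancel_left) auto
    have "\<bar>err i\<bar> \<le> X powr - l" if "i \<in> {1..n}" for i
    proof -
      have "2 * 1 \<le> (2 * real n + 1) * c" using n c1 by (intro mult_mono) auto
      then have "2 * H powr - (w / real n) \<le> (2 * real n + 1) * c * H powr - (w / real n)"
        by (intro mult_right_mono) auto
      then have "\<bar>err i\<bar> \<le> (2 * real n + 1) * c * H powr - (w / real n)"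
        using err_k err_I[of i] that by (cases "i = k") auto
      also have "\<dots> \<le> H powr (w / real n - \<xi> * l) * H powr - (w / real n)"
        using B1(2)[OF H(1)] by (intro mult_right_mono) auto
      also have "\<dots> = X powr - l" unfolding X_def by (simp add: powr_powr powr_add[symmetric])
      finally show ?thesis .
    qed
    with u0_1 u0_X have "simult_approx n \<zeta> l X u" unfolding simult_approx_def err_def by auto
    moreover have "X \<ge> X0" using XH H by simp
    ultimately show ?thesis by blast
  qed
  then show ?thesis unfolding lambda_admissible_def lambda_solvable_1_iff by blast
qed

section \<open>Linearly independent solutions\<close>

text \<open>Greedy choice: Siegel's lemma supplies a nonzero \<open>p\<close> orthogonal to the at
  most \<open>n\<close> vectors found so far, and any \<open>u\<close> off the hyperplane of
  \<open>p\<close> is independent of them.\<close>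

lemma lin_indep_if_no_hyperplane:
  fixes K :: "(nat \<Rightarrow> int) \<Rightarrow> bool"
  assumes off: "\<And>p. \<exists>i\<le>n. p i \<noteq> 0 \<Longrightarrow> \<exists>u. K u \<and> (\<Sum>i\<le>n. p i * u i) \<noteq> 0"
  shows "j \<le> n + 1 \<Longrightarrow> \<exists>v. lin_indep_int n j v \<and> (\<forall>k<j. K (v k))"
proof (induction j)
  case 0
  then show ?case by (auto simp: lin_indep_int_def)
next
  case (Suc j)
  then obtain v where v: "lin_indep_int n j v" "\<And>k. k < j \<Longrightarrow> K (v k)" by auto
  define B where "B = nat (\<Sum>k<j. \<Sum>i<Suc n. \<bar>v k i\<bar>)"
  have "(\<Sum>i<Suc n. \<bar>v k i\<bar>) \<le> int B" if "k < j" for k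
  proof -
    have "(\<Sum>i<Suc n. \<bar>v k i\<bar>) \<le> (\<Sum>k<j. \<Sum>i<Suc n. \<bar>v k i\<bar>)"
      using that by (intro member_le_sum[of k "{..<j}" "\<lambda>k. \<Sum>i<Suc n. \<bar>v k i\<bar>"]) (auto intro!: add_nonneg_nonneg sum_nonneg)
    then show ?thesis unfolding B_def by linarith
  qed
  moreover have "j < Suc n" using Suc.prems by simp
  ultimately obtain p where p: "\<exists>i<Suc n. p i \<noteq> 0" "\<And>k. k < j \<Longrightarrow> (\<Sum>i<Suc n. p i * v k i) = 0"
    using siegel_more_unknowns[where M = j and N = "Suc n" and b = v] by blast
  from p(1) have "\<exists>i\<le>n. p i \<noteq> 0" by (simp add: less_Suc_eq_le)
  from off[OF this] obtain u where u: "K u" "(\<Sum>i\<le>n. p i * u i) \<noteq> 0" by blast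
  define v' where "v' = v(j := u)"
  have "lin_indep_int n (Suc j) v'"
    unfolding lin_indep_int_def
  proof (intro allI impI)
    fix c :: "nat \<Rightarrow> int" and k
    assume c: "\<forall>i\<le>n. (\<Sum>k<Suc j. c k * v' k i) = 0" and k: "k < Suc j"
    have "0 = (\<Sum>i\<le>n. p i * (\<Sum>k<Suc j. c k * v' k i))" using c by simp
    also have "\<dots> = (\<Sum>i\<le>n. \<Sum>k<Suc j. c k * (p i * v' k i))"
      by (intro sum.cong refl) (simp only: sum_distrib_left mult.left_commute)
    also have "\<dots> = (\<Sum>k<Suc j. \<Sum>i\<le>n. c k * (p i * v' k i))" by (rule sum.swap)
    also have "\<dots> = (\<Sum>k<Suc j. c k * (\<Sum>i\<le>n. p i * v' k i))"
      by (simp only: sum_distrib_left)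
    also have "\<dots> = c j * (\<Sum>i\<le>n. p i * u i) + (\<Sum>k<j. c k * (\<Sum>i\<le>n. p i * v k i))"
      by (simp add: v'_def)
    also have "(\<Sum>k<j. c k * (\<Sum>i\<le>n. p i * v k i)) = 0"
      using p(2) unfolding lessThan_Suc_atMost by (intro sum.neutral) auto
    finally have cj: "c j = 0" using u(2) by simp
    with c have "\<forall>i\<le>n. (\<Sum>k<j. c k * v k i) = 0" by (simp add: v'_def)
    with v(1) have "\<forall>k<j. c k = 0" unfolding lin_indep_int_def by blast
    with cj k show "c k = 0" by (metis less_Suc_eq)
  qed
  moreover have "\<forall>k<Suc j. K (v' k)" using v(2) u(1) by (auto simp: v'_def less_Suc_eq)
  ultimately show ?case by blast
qed

text \<open>A packing argument. If all points of the box dilated by \<open>s\<close> lay in the hyperplane orthogonal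
  to \<open>p\<close>, one of their normalised coordinates would be controlled by the other \<open>n\<close> ones. Since
  the box contains too many points for these \<open>n\<close> coordinates to be separated, two points would
  differ by a point of the box dilated by \<open>t\<close>.\<close>

lemma exists_point_off_hyperplane:
  fixes p :: "nat \<Rightarrow> int" and s t Y \<delta> \<zeta> :: real and k n :: nat
  assumes p: "\<exists>i\<le>n. p i \<noteq> 0" and pos: "s > 0" "t > 0" "Y > 0" "\<delta> > 0" and s\<delta>: "s * \<delta> \<le> 1"
    and many: "real k * (2 / (s * \<delta>)) ^ n \<le> s * Y"
    and boxes: "(2 * s * (real n + 1) / t + 1) ^ n \<le> real k"
    and none: "\<And>u :: nat \<Rightarrow> int. 1 \<le> \<bar>u 0\<bar> \<Longrightarrow> real_of_int \<bar>u 0\<bar> \<le> t * Y \<Longrightarrow>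
      \<exists>i\<in>{1..n}. \<bar>\<zeta> ^ i * of_int (u 0) - of_int (u i)\<bar> > t * \<delta>"
  shows "\<exists>u. (real_of_int \<bar>u 0\<bar> \<le> s * Y \<and>
      (\<forall>i\<in>{1..n}. \<bar>\<zeta> ^ i * of_int (u 0) - of_int (u i)\<bar> \<le> s * \<delta>)) \<and> (\<Sum>i\<le>n. p i * u i) \<noteq> 0"
proof (rule ccontr)
  assume "\<not> ?thesis"
  then have orth: "(\<Sum>i\<le>n. p i * u i) = 0" if "real_of_int \<bar>u 0\<bar> \<le> s * Y"
    "\<And>i. i \<in> {1..n} \<Longrightarrow> \<bar>\<zeta> ^ i * of_int (u 0) - of_int (u i)\<bar> \<le> s * \<delta>" for u :: "nat \<Rightarrow> int"
    using that by blast
  define Q where "Q = nat \<lceil>1 / (s * \<delta>)\<rceil>"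
  have s\<delta>0: "s * \<delta> > 0" using pos by simp
  have r1: "1 / (s * \<delta>) \<ge> 1" using s\<delta> s\<delta>0 by simp
  then have Qge: "real Q \<ge> 1 / (s * \<delta>)" and Q1: "Q \<ge> 1" and "real Q \<le> 1 / (s * \<delta>) + 1"
    unfolding Q_def by linarith+
  moreover have "2 / (s * \<delta>) = 1 / (s * \<delta>) + 1 / (s * \<delta>)" by simp
  ultimately have Qle: "real Q \<le> 2 / (s * \<delta>)" using r1 by linarith
  have Qinv: "1 / real Q \<le> s * \<delta>" using Qge Q1 s\<delta>0 by (simp add: field_simps)
  \<comment> \<open>The numbers below \<open>M\<close> are the naturals up to \<open>s * Y\<close>;
    by \<open>many\<close>, more than \<open>k\<close> of them share a cell of side at most
    \<open>s * \<delta>\<close>.\<close>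
  define M where "M = nat \<lfloor>s * Y\<rfloor> + 1"
  have "real k * real Q ^ n \<le> real k * (2 / (s * \<delta>)) ^ n"
    using Qle by (intro mult_left_mono power_mono) auto
  also note many
  also have "s * Y < real M" unfolding M_def using pos by linarith
  finally have "real (k * (Q ^ card {1..n} * card {()})) < real M" by simp
  then have less: "k * (Q ^ card {1..n} * card {()}) < M" by (simp only: of_nat_less_iff)
  obtain S where S: "S \<subseteq> {..<M}" "card S > k"
    "\<And>x y i. x \<in> S \<Longrightarrow> y \<in> S \<Longrightarrow> i \<in> {1..n} \<Longrightarrow> \<bar>frac (\<zeta> ^ i * real x) - frac (\<zeta> ^ i * real y)\<bar> \<le> 1 / real Q"
    using many_close_multiples[where g = "\<lambda>_. ()" and \<theta> = "\<lambda>i. \<zeta> ^ i", OF _ _ _ Q1 less] by auto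
  have "S \<noteq> {}" using S(2) by auto
  then obtain x0 where x0: "x0 \<in> S" by blast
  define z where "z = (\<lambda>x i. \<lfloor>\<zeta> ^ i * real x\<rfloor> - \<lfloor>\<zeta> ^ i * real x0\<rfloor>)"
  \<comment> \<open>Coordinates normalised by the box: lying in its dilation by \<open>s\<close>
    becomes \<open>\<bar>L x i\<bar> \<le> s\<close> for every \<open>i\<close>.\<close>
  define L where "L = (\<lambda>x i. if i = 0 then of_int (z x 0) / Y else (\<zeta> ^ i * of_int (z x 0) - of_int (z x i)) / \<delta>)"
  have z0: "real_of_int \<bar>z x 0\<bar> \<le> s * Y" if "x \<in> S" for x
  proof -
    have "x \<in> {..<M}" "x0 \<in> {..<M}" using S(1) that x0 by auto
    moreover have "\<lfloor>s * Y\<rfloor> \<ge> 0" using pos by simp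
    ultimately have "int x \<le> \<lfloor>s * Y\<rfloor>" "int x0 \<le> \<lfloor>s * Y\<rfloor>" unfolding M_def lessThan_iff by linarith+
    then have "\<bar>int x - int x0\<bar> \<le> \<lfloor>s * Y\<rfloor>" by linarith
    then show ?thesis unfolding z_def by simp linarith
  qed
  have zi: "\<bar>\<zeta> ^ i * of_int (z x 0) - of_int (z x i)\<bar> \<le> s * \<delta>" if "x \<in> S" "i \<in> {1..n}" for x i
    unfolding z_def floor_difference_error using S(3)[OF that(1) x0 that(2)] Qinv by linarith
  have L_le: "\<bar>L x i\<bar> \<le> s" if "x \<in> S" "i \<le> n" for x i
    using z0[OF that(1)] zi[OF that(1), of i] that(2) pos unfolding L_def by (auto simp: field_simps)
  \<comment> \<open>The form \<open>p\<close> in the coordinates \<open>L\<close>: writing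
    \<open>z x i\<close> as \<open>\<zeta> ^ i * z x 0\<close> minus its error collects all powers
    of \<open>\<zeta>\<close> in the coefficient of entry 0.\<close>
  define q where "q = (\<lambda>i. if i = 0 then Y * (\<Sum>i\<le>n. of_int (p i) * \<zeta> ^ i) else - (of_int (p i) * \<delta>))"
  have split0: "(\<Sum>i\<le>n. f i) = f 0 + (\<Sum>i=1..n. f i)" for f :: "nat \<Rightarrow> real"
  proof -
    have "{..n} = insert 0 {1..n}" by auto
    then show ?thesis by simp
  qed
  have qL: "(\<Sum>i\<le>n. q i * L x i) = 0" if "x \<in> S" for x
  proof -
    have "(\<Sum>i\<le>n. q i * L x i) = (\<Sum>i\<le>n. of_int (p i) * \<zeta> ^ i) * of_int (z x 0)
        + (\<Sum>i=1..n. - (of_int (p i) * (\<zeta> ^ i * of_int (z x 0) - of_int (z x i))))"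
    proof -
      have "q 0 * L x 0 = (\<Sum>i\<le>n. of_int (p i) * \<zeta> ^ i) * of_int (z x 0)"
        using pos by (simp add: q_def L_def)
      moreover have "(\<Sum>i=1..n. q i * L x i) = (\<Sum>i=1..n. - (of_int (p i) * (\<zeta> ^ i * of_int (z x 0) - of_int (z x i))))"
        using pos by (intro sum.cong) (auto simp: q_def L_def)
      ultimately show ?thesis by (simp add: split0[of "\<lambda>i. q i * L x i"])
    qed
    also have "\<dots> = (\<Sum>i\<le>n. of_int (p i) * of_int (z x i))"
      unfolding split0 by (simp add: algebra_simps sum.distrib sum_subtractf sum_distrib_left sum_distrib_right)
    also have "\<dots> = of_int (\<Sum>i\<le>n. p i * z x i)" by simp
    also have "(\<Sum>i\<le>n. p i * z x i) = 0" using z0 zi that by (intro orth) auto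
    finally show ?thesis by simp
  qed
  have "Max ((\<lambda>i. \<bar>q i\<bar>) ` {..n}) \<in> (\<lambda>i. \<bar>q i\<bar>) ` {..n}" by (intro Max_in) auto
  \<comment> \<open>As \<open>q m\<close> is largest in absolute value, the relation bounds
    coordinate \<open>m\<close> by the sum of the absolute values of the other
    \<open>n\<close>.\<close>
  then obtain m where m: "m \<le> n" "Max ((\<lambda>i. \<bar>q i\<bar>) ` {..n}) = \<bar>q m\<bar>" by (metis atMost_iff imageE)
  have q_max: "\<bar>q i\<bar> \<le> \<bar>q m\<bar>" if "i \<le> n" for i unfolding m(2)[symmetric] using that by (intro Max_ge) auto
  have qm: "\<bar>q m\<bar> > 0"
  proof (rule ccontr)
    assume "\<not> \<bar>q m\<bar> > 0"
    then have q0: "q i = 0" if "i \<le> n" for i using q_max[OF that] by simp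
    then have p0: "p i = 0" if "i \<in> {1..n}" for i using that pos q0[of i] unfolding q_def by auto
    have "(\<Sum>i\<le>n. of_int (p i) * \<zeta> ^ i) = 0" using q0[of 0] pos unfolding q_def by simp
    then have "p 0 = 0" unfolding split0 using p0 by simp
    with p0 p show False by (metis One_nat_def Suc_leI atLeastAtMost_iff gr0I)
  qed
  define I where "I = {..n} - {m}"
  have I: "finite I" "card I = n" unfolding I_def using m by auto
  \<comment> \<open>The other \<open>n\<close> coordinates are sorted into intervals of length
    \<open>t / (n + 1)\<close>, so that for two points in the same class coordinate \<open>m\<close>
    differs by at most \<open>n * t / (n + 1) \<le> t\<close>.\<close>
  define R where "R = nat \<lfloor>2 * s * (real n + 1) / t\<rfloor>"
  define r where "r = (real n + 1) / t"
  have r: "r > 0" unfolding r_def using pos by simp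
  define f where "f = (\<lambda>x. \<lambda>i\<in>I. nat \<lfloor>(L x i + s) * r\<rfloor>)"
  have img: "f ` S \<subseteq> I \<rightarrow>\<^sub>E {..R}"
  proof (intro image_subsetI)
    fix x assume x: "x \<in> S"
    have "nat \<lfloor>(L x i + s) * r\<rfloor> \<le> R" if "i \<in> I" for i
    proof -
      have "L x i + s \<le> 2 * s" using L_le[OF x, of i] that unfolding I_def by auto
      then have "(L x i + s) * r \<le> 2 * s * r" using r by (intro mult_right_mono) auto
      then have "\<lfloor>(L x i + s) * r\<rfloor> \<le> \<lfloor>2 * s * r\<rfloor>" by (rule floor_mono)
      then show ?thesis unfolding R_def r_def by simp
    qed
    then show "f x \<in> I \<rightarrow>\<^sub>E {..R}" unfolding f_def by auto
  qed
  have "real (R + 1) \<le> 2 * s * (real n + 1) / t + 1"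
  proof -
    have "2 * s * (real n + 1) / t \<ge> 0" using pos by simp
    then show ?thesis unfolding R_def by simp
  qed
  then have "real (R + 1) ^ n \<le> (2 * s * (real n + 1) / t + 1) ^ n" by (intro power_mono) auto
  also note boxes
  finally have "real ((R + 1) ^ n) \<le> real k" by simp
  then have Rk: "(R + 1) ^ n \<le> k" by (simp only: of_nat_le_iff)
  have "card (I \<rightarrow>\<^sub>E {..R}) = (R + 1) ^ n" using I by (simp add: card_PiE)
  then have "\<not> inj_on f S"
    using card_inj_on_le[OF _ img] I Rk S(2) by (auto simp: finite_PiE)
  then obtain x y where xy: "x \<in> S" "y \<in> S" "x \<noteq> y" "f x = f y" unfolding inj_on_def by blast
  define D where "D = (\<lambda>i. L x i - L y i)"
  have D_I: "\<bar>D i\<bar> \<le> t / (real n + 1)" if "i \<in> I" for i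
  proof -
    have i: "i \<le> n" using that unfolding I_def by auto
    have "nat \<lfloor>(L x i + s) * r\<rfloor> = nat \<lfloor>(L y i + s) * r\<rfloor>"
      using fun_cong[OF xy(4), of i] that unfolding f_def by simp
    moreover have "(L x i + s) * r \<ge> 0" "(L y i + s) * r \<ge> 0"
      using L_le[OF xy(1) i] L_le[OF xy(2) i] r by auto
    ultimately have "\<bar>(L x i + s) * r - (L y i + s) * r\<bar> \<le> 1" by linarith
    then have "\<bar>D i * r\<bar> \<le> 1" unfolding D_def by (simp add: algebra_simps)
    then have "\<bar>D i\<bar> * r \<le> 1" using r by (simp add: abs_mult)
    then have "\<bar>D i\<bar> \<le> 1 / r" using r by (simp add: field_simps)
    then show ?thesis unfolding r_def by simp
  qed
  have D_m: "\<bar>D m\<bar> \<le> t"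
  proof -
    have "(\<Sum>i\<le>n. q i * D i) = 0"
      using qL[OF xy(1)] qL[OF xy(2)] unfolding D_def by (simp add: right_diff_distrib sum_subtractf)
    moreover have "(\<Sum>i\<le>n. q i * D i) = q m * D m + (\<Sum>i\<in>I. q i * D i)"
      unfolding I_def using m by (intro sum.remove) auto
    ultimately have "q m * D m = - (\<Sum>i\<in>I. q i * D i)" by simp
    then have "\<bar>q m\<bar> * \<bar>D m\<bar> = \<bar>\<Sum>i\<in>I. q i * D i\<bar>" by (metis abs_minus_cancel abs_mult)
    also have "\<dots> \<le> (\<Sum>i\<in>I. \<bar>q m\<bar> * (t / (real n + 1)))"
    proof (intro order_trans[OF sum_abs] sum_mono)
      fix i assume i: "i \<in> I"
      then have "i \<le> n" unfolding I_def by auto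
      with q_max D_I[OF i] show "\<bar>q i * D i\<bar> \<le> \<bar>q m\<bar> * (t / (real n + 1))"
        unfolding abs_mult by (intro mult_mono) auto
    qed
    also have "\<dots> = \<bar>q m\<bar> * (real n * (t / (real n + 1)))" using I by simp
    finally have "\<bar>D m\<bar> \<le> real n * (t / (real n + 1))" using qm by (subst (asm) mult_le_cancel_left_pos) auto
    also have "\<dots> \<le> t" using pos by (simp add: field_simps)
    finally show ?thesis .
  qed
  have D: "\<bar>D i\<bar> \<le> t" if "i \<le> n" for i
  proof (cases "i = m")
    case False
    then have "\<bar>D i\<bar> \<le> t / (real n + 1)" using D_I that unfolding I_def by auto
    also have "\<dots> \<le> t" using pos by (simp add: field_simps)
    finally show ?thesis .
  qed (use D_m in simp)
  define u where "u = (\<lambda>i. z x i - z y i)"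
  have "1 \<le> \<bar>u 0\<bar>" using xy(3) unfolding u_def z_def by simp
  moreover have "real_of_int \<bar>u 0\<bar> \<le> t * Y"
  proof -
    have "D 0 = of_int (u 0) / Y" unfolding D_def L_def u_def by (simp add: diff_divide_distrib)
    with D[of 0] show ?thesis using pos by (simp add: field_simps)
  qed
  ultimately obtain i where i: "i \<in> {1..n}" "\<bar>\<zeta> ^ i * of_int (u 0) - of_int (u i)\<bar> > t * \<delta>"
    using none by blast
  have "D i = (\<zeta> ^ i * of_int (u 0) - of_int (u i)) / \<delta>"
    using i(1) pos unfolding D_def L_def u_def by (simp add: field_simps)
  with D[of i] i have "\<bar>\<zeta> ^ i * of_int (u 0) - of_int (u i)\<bar> \<le> t * \<delta>" using pos by (simp add: field_simps)
  with i show False by simp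
qed

text \<open>At scale \<open>Y\<close>, consider the box with sides \<open>Y\<close> and
  \<open>Y powr - (1 / n)\<close>. Shrunk by \<open>t = Y powr - \<epsilon>\<close> it contains no
  approximation, since exponents above \<open>1 / n\<close> are not admissible; enlarged by
  \<open>s = Y powr \<sigma>\<close> it therefore has points off every hyperplane.\<close>

lemma lambda_uniform_all_indices:
  fixes \<zeta> :: real
  assumes n: "n \<ge> 1" and not_adm: "\<And>l. l > 1 / real n \<Longrightarrow> \<not> lambda_admissible n 1 \<zeta> l"
    and l: "0 < l" "l < 1 / real n"
  shows "lambda_uniform n (n + 1) \<zeta> l"
proof -
  \<comment> \<open>Solves \<open>(1 + \<sigma>) * l = 1 / n - \<sigma>\<close>: the enlarged box is
    exactly that of exponent \<open>l\<close> at \<open>X = Y powr (1 + \<sigma>)\<close>.\<close>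
  define \<sigma> where "\<sigma> = (1 / real n - l) / (1 + l)"
  \<comment> \<open>The packing count has order \<open>Y powr (1 + n * \<epsilon>)\<close> and must
    stay below \<open>s * Y = Y powr (1 + \<sigma>)\<close>; this \<open>\<epsilon>\<close> leaves
    \<open>Y powr (\<sigma> / 2)\<close> for the constants.\<close>
  define \<epsilon> where "\<epsilon> = \<sigma> / (2 * real n)"
  have \<sigma>0: "\<sigma> > 0" unfolding \<sigma>_def using l by simp
  have "\<sigma> * (1 + l) = 1 / real n - l" unfolding \<sigma>_def using l by simp
  then have \<sigma>l: "\<sigma> - 1 / real n = - ((1 + \<sigma>) * l)" by (simp add: algebra_simps)
  have "(1 + \<sigma>) * l > 0" using \<sigma>0 l by simp
  with \<sigma>l have \<sigma>n: "\<sigma> < 1 / real n" by linarith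
  have "1 / real n \<le> 1" using n by simp
  with \<sigma>n have \<sigma>1: "\<sigma> < 1" by linarith
  have \<epsilon>0: "\<epsilon> > 0" unfolding \<epsilon>_def using \<sigma>0 n by simp
  have "\<epsilon> \<le> \<sigma>" unfolding \<epsilon>_def using n \<sigma>0 by (simp add: field_simps)
  then have \<epsilon>1: "\<epsilon> < 1" using \<sigma>1 by linarith
  have \<epsilon>n: "\<epsilon> * real n = \<sigma> / 2" unfolding \<epsilon>_def using n by simp
  \<comment> \<open>The exponent of the shrunken box: \<open>Y powr - (1 / n + \<epsilon>)\<close>
    is the power \<open>- l1\<close> of \<open>Y powr (1 - \<epsilon>)\<close>.\<close>
  define l1 where "l1 = (1 / real n + \<epsilon>) / (1 - \<epsilon>)"
  have "1 / real n * (1 - \<epsilon>) \<le> 1 / real n * 1" using \<epsilon>0 by (intro mult_left_mono) auto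
  then have "1 / real n * (1 - \<epsilon>) < 1 / real n + \<epsilon>" using \<epsilon>0 by linarith
  then have "l1 > 1 / real n" unfolding l1_def using \<epsilon>1 by (subst pos_less_divide_eq) auto
  from not_adm[OF this] obtain X1 where
    X1: "\<And>X u. X \<ge> X1 \<Longrightarrow> \<not> simult_approx n \<zeta> l1 X u"
    unfolding lambda_admissible_def lambda_solvable_1_iff by blast
  have "1 - \<epsilon> > 0" using \<epsilon>1 by simp
  from const_le_powr[OF this, of X1] obtain Y1 where
    Y1: "Y1 \<ge> 1" "\<And>Y. Y \<ge> Y1 \<Longrightarrow> X1 \<le> Y powr (1 - \<epsilon>)" by metis
  have "\<sigma> / 2 > 0" using \<sigma>0 by simp
  from const_le_powr[OF this, of "2 * (8 * (real n + 1)) ^ n"] obtain Y2 where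
    Y2: "Y2 \<ge> 1" "\<And>Y. Y \<ge> Y2 \<Longrightarrow> 2 * (8 * (real n + 1)) ^ n \<le> Y powr (\<sigma> / 2)" by metis
  have "1 / (1 + \<sigma>) > 0" using \<sigma>0 by simp
  from const_le_powr[OF this, of "max (max Y1 Y2) 2"] obtain X0 where
    X0: "X0 \<ge> 1" "\<And>X. X \<ge> X0 \<Longrightarrow> max (max Y1 Y2) 2 \<le> X powr (1 / (1 + \<sigma>))" by metis
  have "lambda_solvable n (n + 1) \<zeta> l X" if X: "X \<ge> X0" for X
  proof -
    define Y where "Y = X powr (1 / (1 + \<sigma>))"
    have Y: "Y \<ge> Y1" "Y \<ge> Y2" "Y \<ge> 2" using X0(2)[OF X] unfolding Y_def by auto
    have X_1: "X \<ge> 1" using X X0 by simp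
    define s t \<delta> where "s = Y powr \<sigma>" and "t = Y powr - \<epsilon>" and "\<delta> = Y powr - (1 / real n)"
    have pos: "s > 0" "t > 0" "Y > 0" "\<delta> > 0" unfolding s_def t_def \<delta>_def using Y by auto
    have "s * Y = Y powr (\<sigma> + 1)" unfolding s_def using Y by (simp add: powr_add)
    also have "\<dots> = X" unfolding Y_def using X_1 \<sigma>0 by (simp add: powr_powr add.commute)
    finally have sY: "s * Y = X" .
    have s\<delta>': "s * \<delta> = Y powr (\<sigma> - 1 / real n)" unfolding s_def \<delta>_def by (simp add: powr_add[symmetric])
    also have "\<dots> = X powr - l" unfolding \<sigma>l Y_def using \<sigma>0 by (simp add: powr_powr)
    finally have s\<delta>: "s * \<delta> = X powr - l" .
    have "Y powr (\<sigma> - 1 / real n) < Y powr 0" using \<sigma>n Y by (intro powr_less_mono) auto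
    then have s\<delta>1: "s * \<delta> < 1" unfolding s\<delta>' using Y by simp
    define k where "k = nat \<lceil>(2 * s * (real n + 1) / t + 1) ^ n\<rceil>"
    have boxes: "(2 * s * (real n + 1) / t + 1) ^ n \<le> real k" unfolding k_def by linarith
    have st: "s / t = Y powr (\<sigma> + \<epsilon>)" unfolding s_def t_def by (simp add: powr_minus powr_add divide_inverse)
    then have st1: "s / t \<ge> 1" using Y \<sigma>0 \<epsilon>0 by (simp add: ge_one_powr_ge_zero)
    have n1: "1 \<le> 2 * (real n + 1) * (s / t)"
      using mult_mono[of 1 "2 * (real n + 1)" 1 "s / t"] st1 by simp
    have "2 * s * (real n + 1) / t + 1 = 2 * (real n + 1) * (s / t) + 1" by simp
    also have "\<dots> \<le> 2 * (2 * (real n + 1) * (s / t))"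
    proof -
      have "x + 1 \<le> 2 * x" if "1 \<le> x" for x :: real using that by simp
      then show ?thesis using n1 .
    qed
    also have "\<dots> = 4 * (real n + 1) * (s / t)" by simp
    finally have base: "2 * s * (real n + 1) / t + 1 \<le> 4 * (real n + 1) * (s / t)" .
    have b0: "0 \<le> 2 * s * (real n + 1) / t" using pos by simp
    then have n2: "1 \<le> 4 * (real n + 1) * (s / t)" using base by linarith
    have "real k \<le> (2 * s * (real n + 1) / t + 1) ^ n + 1"
      unfolding k_def using pos by simp
    also have "\<dots> \<le> (4 * (real n + 1) * (s / t)) ^ n + (4 * (real n + 1) * (s / t)) ^ n"
      using base n2 b0 by (intro add_mono power_mono one_le_power) linarith+
    also have "\<dots> = 2 * (4 * (real n + 1)) ^ n * (s / t) ^ n"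
    proof -
      have "(x * y) ^ n + (x * y) ^ n = 2 * x ^ n * y ^ n" for x y :: real by (simp add: power_mult_distrib)
      then show ?thesis .
    qed
    finally have k_le: "real k \<le> 2 * (4 * (real n + 1)) ^ n * (s / t) ^ n" .
    have \<delta>n: "\<delta> ^ n = 1 / Y"
    proof -
      have "\<delta> = inverse (Y powr (1 / real n))" unfolding \<delta>_def by (simp add: powr_minus)
      then show ?thesis using powr_inverse_power[of Y n] pos n by (simp add: power_inverse divide_inverse)
    qed
    have "real k * (2 / (s * \<delta>)) ^ n \<le> 2 * (4 * (real n + 1)) ^ n * (s / t) ^ n * (2 / (s * \<delta>)) ^ n"
      using k_le pos by (intro mult_right_mono) auto
    also have "\<dots> = 2 * (8 * (real n + 1)) ^ n * ((s / t) ^ n / s ^ n * Y)"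
    proof -
      have "(2 / (s * \<delta>)) ^ n = 2 ^ n / s ^ n * Y"
        unfolding power_divide power_mult_distrib \<delta>n by simp
      moreover have "(8 * (real n + 1)) ^ n = (4 * (real n + 1)) ^ n * 2 ^ n"
        by (subst power_mult_distrib[symmetric]) (simp add: algebra_simps)
      ultimately show ?thesis by simp
    qed
    also have "\<dots> \<le> Y powr (\<sigma> / 2) * ((s / t) ^ n / s ^ n * Y)"
      using Y2(2)[OF Y(2)] pos by (intro mult_right_mono) auto
    also have "(s / t) ^ n / s ^ n = Y powr (\<sigma> / 2)"
    proof -
      have "(s / t) ^ n / s ^ n = (1 / t) ^ n" using pos by (simp add: power_divide)
      also have "1 / t = Y powr \<epsilon>" unfolding t_def by (simp add: powr_minus divide_inverse)
      also have "(Y powr \<epsilon>) ^ n = Y powr (\<epsilon> * real n)" using pos by (simp add: powr_realpow[symmetric] powr_powr)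
      finally show ?thesis unfolding \<epsilon>n .
    qed
    also have "Y powr (\<sigma> / 2) * (Y powr (\<sigma> / 2) * Y) = s * Y"
      unfolding s_def by (simp add: mult.assoc[symmetric] powr_add[symmetric])
    finally have many: "real k * (2 / (s * \<delta>)) ^ n \<le> s * Y" .
    have none: "\<exists>i\<in>{1..n}. \<bar>\<zeta> ^ i * of_int (u 0) - of_int (u i)\<bar> > t * \<delta>"
      if u: "1 \<le> \<bar>u 0\<bar>" "real_of_int \<bar>u 0\<bar> \<le> t * Y" for u :: "nat \<Rightarrow> int"
    proof (rule ccontr)
      assume "\<not> ?thesis"
      then have small: "\<bar>\<zeta> ^ i * of_int (u 0) - of_int (u i)\<bar> \<le> t * \<delta>" if "i \<in> {1..n}" for i
        using that by (meson not_le)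
      define X' where "X' = Y powr (1 - \<epsilon>)"
      have "t * Y = X'" unfolding t_def X'_def using pos by (simp add: powr_diff powr_minus divide_inverse mult.commute)
      moreover have "t * \<delta> = X' powr - l1"
      proof -
        have "t * \<delta> = Y powr - (1 / real n + \<epsilon>)"
          unfolding t_def \<delta>_def minus_add_distrib powr_add by (rule mult.commute)
        also have "1 / real n + \<epsilon> = (1 - \<epsilon>) * l1" unfolding l1_def using \<epsilon>1 by simp
        finally show ?thesis unfolding X'_def by (simp add: powr_powr)
      qed
      ultimately have "simult_approx n \<zeta> l1 X' u"
        unfolding simult_approx_def using u small by simp
      with X1[OF Y1(2)[OF Y(1)]] show False unfolding X'_def by blast
    qed
    define K where "K = (\<lambda>u :: nat \<Rightarrow> int. real_of_int \<bar>u 0\<bar> \<le> s * Y \<and>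
      (\<forall>i\<in>{1..n}. \<bar>\<zeta> ^ i * of_int (u 0) - of_int (u i)\<bar> \<le> s * \<delta>))"
    have "\<exists>u. K u \<and> (\<Sum>i\<le>n. p i * u i) \<noteq> 0" if "\<exists>i\<le>n. p i \<noteq> 0" for p
      unfolding K_def using exists_point_off_hyperplane[OF that pos less_imp_le[OF s\<delta>1] many boxes none] .
    from lin_indep_if_no_hyperplane[of n K, OF this order_refl]
    obtain v where v: "lin_indep_int n (n + 1) v" "\<And>k. k < n + 1 \<Longrightarrow> K (v k)" by auto
    have "simult_approx n \<zeta> l X (v k)" if k: "k < n + 1" for k
    proof -
      \<comment> \<open>With denominator 0, all entries would be at most
        \<open>s * \<delta> < 1\<close> in absolute value, so the vector would be zero, against
        independence.\<close>
      have "v k 0 \<noteq> 0"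
      proof
        assume v0: "v k 0 = 0"
        have "v k i = 0" if "i \<le> n" for i
        proof (cases "i = 0")
          case False
          then have "\<bar>\<zeta> ^ i * of_int (v k 0) - of_int (v k i)\<bar> \<le> s * \<delta>" using v(2)[OF k] that unfolding K_def by auto
          then have "\<bar>real_of_int (v k i)\<bar> < 1" using s\<delta>1 v0 by simp
          then show ?thesis by linarith
        qed (use v0 in simp)
        then have "\<forall>i\<le>n. (\<Sum>r<n + 1. (if r = k then 1 else 0) * v r i) = 0"
          by (auto intro!: sum.neutral)
        with spec[OF v(1)[unfolded lin_indep_int_def], of "\<lambda>r. if r = k then 1 else 0"]
        have "\<forall>r<n + 1. (if r = k then 1 else 0 :: int) = 0" by (rule mp)
        with k show False by auto
      qed
      then show ?thesis using v(2)[OF k] unfolding K_def simult_approx_def sY s\<delta> by auto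
    qed
    with v(1) show ?thesis unfolding lambda_solvable_def by blast
  qed
  then show ?thesis unfolding lambda_uniform_def by blast
qed

section \<open>Prolonging approximations along a polynomial with tiny value\<close>

text \<open>Multiplying by the leading coefficient turns the relation \<open>P(\<zeta>) \<approx> 0\<close> into a recursion for
  further integer coordinates.\<close>

lemma prolong_approximation:
  fixes a u :: "nat \<Rightarrow> int" and \<zeta> H \<delta> \<eta> :: real
  assumes a_le: "\<And>i. i \<le> h + 1 \<Longrightarrow> \<bar>real_of_int (a i)\<bar> \<le> H" and H: "H \<ge> 1"
    and err: "\<And>i. i \<le> h \<Longrightarrow> \<bar>\<zeta> ^ i * of_int (u 0) - of_int (u i)\<bar> \<le> \<delta>"
    and \<eta>: "\<bar>of_int (u 0) * (\<Sum>i\<le>h + 1. of_int (a i) * \<zeta> ^ i)\<bar> \<le> \<eta>"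
  shows "\<exists>z. (\<forall>i\<le>h. z i = a (h + 1) ^ s * u i) \<and>
    (\<forall>i\<le>h + s. \<bar>of_int (a (h + 1)) ^ s * \<zeta> ^ i * of_int (u 0) - of_int (z i)\<bar>
       \<le> (2 * (real h + 1) * H * max 1 \<bar>\<zeta>\<bar>) ^ s * (\<delta> + \<eta>))"
proof (induction s)
  case 0
  have "\<eta> \<ge> 0" using \<eta> by linarith
  then show ?case using err by (intro exI[of _ u]) (auto intro: add_increasing2)
next
  case (Suc s)
  let ?a = "real_of_int (a (h + 1))" and ?Z = "max 1 \<bar>\<zeta>\<bar>"
  let ?G = "2 * (real h + 1) * H * ?Z"
  define p where "p = (\<Sum>i\<le>h + 1. of_int (a i) * \<zeta> ^ i)"
  from Suc obtain z where z: "\<And>i. i \<le> h \<Longrightarrow> z i = a (h + 1) ^ s * u i"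
    "\<And>i. i \<le> h + s \<Longrightarrow> \<bar>?a ^ s * \<zeta> ^ i * of_int (u 0) - of_int (z i)\<bar> \<le> ?G ^ s * (\<delta> + \<eta>)" by auto
  \<comment> \<open>The new entry \<open>h + s + 1\<close> comes from \<open>p * \<zeta> ^ s\<close>
    being nearly 0: \<open>a (h + 1) * \<zeta> ^ (h + 1 + s)\<close> is close to minus the sum of
    the \<open>a k * \<zeta> ^ (s + k)\<close> with \<open>k \<le> h\<close>.\<close>
  define z' where "z' = (\<lambda>i. if i \<le> h + s then a (h + 1) * z i else - (\<Sum>k\<le>h. a k * z (s + k)))"
  have \<delta>0: "\<delta> \<ge> 0" using err[of 0] by simp
  have \<eta>0: "\<eta> \<ge> 0" using \<eta> by linarith
  have hH: "(real h + 1) * H \<ge> 1" using mult_mono[of 1 "real h + 1" 1 H] H by simp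
  \<comment> \<open>The sum over \<open>k \<le> h\<close> multiplies the error bound by
    \<open>(h + 1) * H\<close>, and the value \<open>p\<close> contributes one more share.\<close>
  have G: "(real h + 1) * H + 1 \<le> ?G"
  proof -
    have "(real h + 1) * H + 1 \<le> 2 * ((real h + 1) * H) * 1" using hH by linarith
    also have "\<dots> \<le> 2 * ((real h + 1) * H) * ?Z" using hH by (intro mult_left_mono) auto
    finally show ?thesis by (simp only: mult.assoc)
  qed
  have G0: "?G \<ge> 0" using G hH by linarith
  have HG: "H \<le> ?G"
  proof -
    have "1 * H \<le> (real h + 1) * H" using H by (intro mult_right_mono) auto
    with G show ?thesis by linarith
  qed
  have HZG: "H * ?Z \<le> ?G"
  proof -
    have "1 * (H * ?Z) \<le> (2 * (real h + 1)) * (H * ?Z)" using H by (intro mult_right_mono) auto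
    then show ?thesis by (simp only: mult.assoc mult_1_left)
  qed
  have E0: "?G ^ s * (\<delta> + \<eta>) \<ge> 0" using G0 \<delta>0 \<eta>0 by simp
  have "\<bar>?a ^ Suc s * \<zeta> ^ i * of_int (u 0) - of_int (z' i)\<bar> \<le> ?G ^ Suc s * (\<delta> + \<eta>)" if i: "i \<le> h + Suc s" for i
  proof (cases "i \<le> h + s")
    case True
    have "?a ^ Suc s * \<zeta> ^ i * of_int (u 0) - of_int (z' i) = ?a * (?a ^ s * \<zeta> ^ i * of_int (u 0) - of_int (z i))"
      using True by (simp add: z'_def algebra_simps)
    then have "\<bar>?a ^ Suc s * \<zeta> ^ i * of_int (u 0) - of_int (z' i)\<bar> = \<bar>?a\<bar> * \<bar>?a ^ s * \<zeta> ^ i * of_int (u 0) - of_int (z i)\<bar>"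
      by (simp only: abs_mult)
    also have "\<dots> \<le> ?G * (?G ^ s * (\<delta> + \<eta>))"
      using a_le[of "h + 1"] HG z(2)[OF True] G0 by (intro mult_mono) auto
    finally show ?thesis by (simp only: power_Suc mult.assoc)
  next
    case False
    then have i: "i = s + (h + 1)" using i by simp
    have ap: "?a * \<zeta> ^ (h + 1) = p - (\<Sum>k\<le>h. of_int (a k) * \<zeta> ^ k)" unfolding p_def by simp
    have "?a ^ Suc s * \<zeta> ^ i * of_int (u 0) = ?a ^ s * \<zeta> ^ s * of_int (u 0) * (?a * \<zeta> ^ (h + 1))"
      unfolding i by (simp only: power_add power_Suc mult_ac)
    also have "\<dots> = ?a ^ s * \<zeta> ^ s * (of_int (u 0) * p) - (\<Sum>k\<le>h. of_int (a k) * (?a ^ s * \<zeta> ^ (s + k) * of_int (u 0)))"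
      unfolding ap by (simp only: right_diff_distrib sum_distrib_left power_add mult_ac)
    finally have split: "?a ^ Suc s * \<zeta> ^ i * of_int (u 0) - of_int (z' i)
        = ?a ^ s * \<zeta> ^ s * (of_int (u 0) * p) - (\<Sum>k\<le>h. of_int (a k) * (?a ^ s * \<zeta> ^ (s + k) * of_int (u 0) - of_int (z (s + k))))"
      using False by (simp add: z'_def right_diff_distrib sum_subtractf)
    have part1: "\<bar>?a ^ s * \<zeta> ^ s * (of_int (u 0) * p)\<bar> \<le> ?G ^ s * (\<delta> + \<eta>)"
    proof -
      have "\<bar>?a ^ s * \<zeta> ^ s\<bar> = (\<bar>?a\<bar> * \<bar>\<zeta>\<bar>) ^ s" by (simp only: abs_mult power_abs power_mult_distrib)
      also have "\<dots> \<le> (H * ?Z) ^ s" using a_le[of "h + 1"] H by (intro power_mono mult_mono) auto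
      also have "\<dots> \<le> ?G ^ s" using HZG H by (intro power_mono) auto
      finally have "\<bar>?a ^ s * \<zeta> ^ s\<bar> \<le> ?G ^ s" .
      moreover have "\<bar>of_int (u 0) * p\<bar> \<le> \<delta> + \<eta>" using \<eta> \<delta>0 unfolding p_def by linarith
      ultimately show ?thesis using G0 by (subst abs_mult) (intro mult_mono, auto)
    qed
    have part2: "\<bar>\<Sum>k\<le>h. of_int (a k) * (?a ^ s * \<zeta> ^ (s + k) * of_int (u 0) - of_int (z (s + k)))\<bar>
        \<le> (\<Sum>k\<le>h. H * (?G ^ s * (\<delta> + \<eta>)))"
    proof (intro order_trans[OF sum_abs] sum_mono)
      fix k assume "k \<in> {..h}"
      then show "\<bar>of_int (a k) * (?a ^ s * \<zeta> ^ (s + k) * of_int (u 0) - of_int (z (s + k)))\<bar> \<le> H * (?G ^ s * (\<delta> + \<eta>))"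
        using a_le[of k] z(2)[of "s + k"] H by (subst abs_mult) (intro mult_mono, auto)
    qed
    have "\<bar>?a ^ Suc s * \<zeta> ^ i * of_int (u 0) - of_int (z' i)\<bar>
        \<le> ?G ^ s * (\<delta> + \<eta>) + (\<Sum>k\<le>h. H * (?G ^ s * (\<delta> + \<eta>)))"
      unfolding split by (rule order_trans[OF abs_triangle_ineq4 add_mono[OF part1 part2]])
    also have "\<dots> = ((real h + 1) * H + 1) * (?G ^ s * (\<delta> + \<eta>))"
    proof -
      have "E + (\<Sum>k\<le>h. H * E) = ((real h + 1) * H + 1) * E" for E :: real by (simp add: algebra_simps)
      then show ?thesis .
    qed
    also have "\<dots> \<le> ?G * (?G ^ s * (\<delta> + \<eta>))" using G E0 by (intro mult_right_mono) auto
    finally show ?thesis by (simp only: power_Suc mult.assoc)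
  qed
  moreover have "z' i = a (h + 1) ^ Suc s * u i" if "i \<le> h" for i
    using that z(1)[OF that] by (simp add: z'_def)
  ultimately show ?case by blast
qed

text \<open>The hypothesis is used at an exponent \<open>l'\<close> strictly between
  \<open>l\<close> and \<open>\<tau>\<close>; \<open>K\<close> times the gap \<open>l' - l\<close>
  pays for the powers of \<open>H\<close> spent. The scales obtained are tied to the heights of the
  polynomials, so the conclusion is \<open>lambda_admissible\<close> only.\<close>

lemma lambda_admissible_prolong:
  fixes \<zeta> :: real
  assumes winf: "w_exponent (h + 1) \<zeta> = \<infinity>" and hn: "h \<le> n"
    and unif: "\<And>l. 0 < l \<Longrightarrow> l < \<tau> \<Longrightarrow> lambda_uniform h j \<zeta> l"
    and l: "0 < l" "l < \<tau>"
  shows "lambda_admissible n j \<zeta> l"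
  unfolding lambda_admissible_def
proof
  fix X0 :: real
  define l' where "l' = (l + \<tau>) / 2"
  have l': "l < l'" "l' < \<tau>" unfolding l'_def using l by auto
  obtain X1 where X1: "\<And>X. X \<ge> X1 \<Longrightarrow> lambda_solvable h j \<zeta> l' X"
    using unif[of l'] l l' unfolding lambda_uniform_def by auto
  define r where "r = n - h"
  define Z where "Z = max 1 \<bar>\<zeta>\<bar>"
  define C0 where "C0 = Z ^ (h + 1)"
  define C where "C = (2 * (real h + 1) * Z) ^ r * (1 + C0)"
  \<comment> \<open>The size bound becomes \<open>Y = H powr (r + K)\<close> and the error bound
    \<open>H powr (1 + r - K * l')\<close>, the summand 1 absorbing the constant
    \<open>C \<le> H\<close>. This \<open>K\<close> makes the latter equal to
    \<open>Y powr - l\<close>.\<close>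
  define K where "K = (real r + real r * l + 1) / (l' - l)"
  have K0: "K > 0" unfolding K_def using l l' by (intro divide_pos_pos add_nonneg_pos) auto
  have K: "K * (l' - l) = real r + real r * l + 1" unfolding K_def using l' by simp
  \<comment> \<open>Gives \<open>X * H powr - w = X powr - l'\<close>, so that the value of
    \<open>P\<close> times a denominator is of the order of the approximation error.\<close>
  define w where "w = K + K * l'"
  have inf: "infinite (w_approximants (h + 1) \<zeta> w)"
    using winf by (intro infinite_approximants_if_less_w) auto
  from const_le_powr[OF K0, of X1] obtain B1 where
    B1: "B1 \<ge> 1" "\<And>H. H \<ge> B1 \<Longrightarrow> X1 \<le> H powr K" by metis
  have rK: "real r + K > 0" using K0 by simp
  from const_le_powr[OF rK, of X0] obtain B2 where
    B2: "B2 \<ge> 1" "\<And>H. H \<ge> B2 \<Longrightarrow> X0 \<le> H powr (real r + K)" by metis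
  from w_approximants_unbounded[OF inf, of "max (max B1 B2) C"] obtain P where
    P: "P \<in> w_approximants (h + 1) \<zeta> w" and big: "real_of_int (poly_height P) \<ge> max (max B1 B2) C" by blast
  define H where "H = real_of_int (poly_height P)"
  have H: "H \<ge> B1" "H \<ge> B2" "H \<ge> C" using big unfolding H_def by auto
  have H1: "H \<ge> 1" using H B1 by simp
  have deg: "degree P \<le> h + 1" and p_le: "\<bar>poly (map_poly of_int P) \<zeta>\<bar> \<le> H powr - w"
    using P unfolding w_approximants_def H_def by auto
  \<comment> \<open>\<open>P\<close> may have degree below \<open>h + 1\<close>; multiplying it by
    the \<open>e\<close>-th power of the variable puts its leading coefficient at index
    \<open>h + 1\<close>.\<close>
  define e where "e = h + 1 - degree P"
  have e: "h + 1 = e + degree P" unfolding e_def using deg by simp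
  define a where "a = (\<lambda>i. if i < e then 0 else coeff P (i - e))"
  have a_le: "\<bar>real_of_int (a i)\<bar> \<le> H" for i
    using abs_coeff_le_height[of P "i - e"] H1 unfolding a_def H_def by (auto simp flip: of_int_abs)
  have "coeff P (degree P) \<noteq> 0" using w_approximants_nonzero[OF P] leading_coeff_0_iff[of P] by blast
  then have a0: "a (h + 1) \<noteq> 0" unfolding a_def e by simp
  define p where "p = (\<Sum>i\<le>h + 1. of_int (a i) * \<zeta> ^ i)"
  have "p = (\<Sum>i\<in>{e..e + degree P}. of_int (a i) * \<zeta> ^ i)"
    unfolding p_def e by (intro sum.mono_neutral_right) (auto simp: a_def)
  also have "\<dots> = (\<Sum>i\<le>degree P. of_int (coeff P i) * \<zeta> ^ (e + i))"
    by (rule sum.reindex_bij_witness[of _ "\<lambda>i. e + i" "\<lambda>i. i - e"]) (auto simp: a_def)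
  also have "\<dots> = \<zeta> ^ e * poly (map_poly of_int P) \<zeta>"
    unfolding poly_of_int_eq_sum[OF order_refl] by (simp add: power_add sum_distrib_left algebra_simps)
  finally have p_eq: "p = \<zeta> ^ e * poly (map_poly of_int P) \<zeta>" .
  have p_le': "\<bar>p\<bar> \<le> C0 * H powr - w"
    unfolding p_eq abs_mult power_abs C0_def Z_def
    using p_le by (intro mult_mono abs_power_le_max_power) (auto simp: e_def)
  define X where "X = H powr K"
  have X_pos: "X > 0" unfolding X_def using H1 by simp
  obtain v where v: "lin_indep_int h j v" "\<And>k. k < j \<Longrightarrow> simult_approx h \<zeta> l' X (v k)"
    using X1[OF B1(2)[OF H(1)]] unfolding lambda_solvable_def X_def by blast
  define \<eta> where "\<eta> = C0 * X powr - l'"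
  define G where "G = 2 * (real h + 1) * H * max 1 \<bar>\<zeta>\<bar>"
  have "\<exists>z. (\<forall>i\<le>h. z i = a (h + 1) ^ r * v k i) \<and>
    (\<forall>i\<le>h + r. \<bar>of_int (a (h + 1)) ^ r * \<zeta> ^ i * of_int (v k 0) - of_int (z i)\<bar> \<le> G ^ r * (X powr - l' + \<eta>))"
    if k: "k < j" for k
    unfolding G_def
  proof (rule prolong_approximation[OF a_le H1])
    show "\<bar>\<zeta> ^ i * of_int (v k 0) - of_int (v k i)\<bar> \<le> X powr - l'" if "i \<le> h" for i
      using v(2)[OF k] that unfolding simult_approx_def by (cases "i = 0") auto
    have "\<bar>of_int (v k 0) * p\<bar> \<le> X * (C0 * H powr - w)"
      using v(2)[OF k] p_le' X_pos unfolding simult_approx_def by (subst abs_mult) (intro mult_mono, auto)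
    also have "\<dots> = C0 * H powr (K + - w)" unfolding X_def by (simp only: powr_add mult_ac)
    also have "\<dots> = \<eta>" unfolding w_def \<eta>_def X_def by (simp add: powr_powr)
    finally show "\<bar>of_int (v k 0) * (\<Sum>i\<le>h + 1. of_int (a i) * \<zeta> ^ i)\<bar> \<le> \<eta>" unfolding p_def .
  qed
  then obtain z where z: "\<And>k i. k < j \<Longrightarrow> i \<le> h \<Longrightarrow> z k i = a (h + 1) ^ r * v k i"
    "\<And>k i. k < j \<Longrightarrow> i \<le> h + r \<Longrightarrow>
      \<bar>of_int (a (h + 1)) ^ r * \<zeta> ^ i * of_int (v k 0) - of_int (z k i)\<bar> \<le> G ^ r * (X powr - l' + \<eta>)"
    by metis
  define Y where "Y = H powr (real r + K)"
  have "G = (2 * (real h + 1) * Z) * H" unfolding G_def Z_def by simp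
  then have "G ^ r = (2 * (real h + 1) * Z) ^ r * H powr real r"
    using H1 by (simp only: power_mult_distrib) (simp add: powr_realpow)
  then have "G ^ r * (X powr - l' + \<eta>) = C * (H powr real r * X powr - l')"
    unfolding C_def \<eta>_def by (simp add: distrib_left distrib_right)
  also have "\<dots> \<le> H powr 1 * (H powr real r * X powr - l')"
    using H H1 by (intro mult_right_mono) auto
  also have "\<dots> = H powr (1 + real r - K * l')"
    unfolding X_def by (simp only: powr_powr powr_add[symmetric] mult.assoc[symmetric]) (simp add: algebra_simps)
  also have "1 + real r - K * l' = - ((real r + K) * l)" using K by (simp add: algebra_simps)
  also have "H powr \<dots> = Y powr - l" unfolding Y_def by (simp add: powr_powr)
  finally have err: "G ^ r * (X powr - l' + \<eta>) \<le> Y powr - l" .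
  have "simult_approx n \<zeta> l Y (z k)" if k: "k < j" for k
  proof -
    have z0: "z k 0 = a (h + 1) ^ r * v k 0" using z(1)[OF k] by simp
    have v0: "v k 0 \<noteq> 0" "\<bar>real_of_int (v k 0)\<bar> \<le> X" using v(2)[OF k] unfolding simult_approx_def by auto
    have "z k 0 \<noteq> 0" unfolding z0 using a0 v0 by simp
    then have "1 \<le> \<bar>z k 0\<bar>" by linarith
    moreover have "real_of_int \<bar>z k 0\<bar> \<le> Y"
    proof -
      have "real_of_int \<bar>z k 0\<bar> = \<bar>real_of_int (a (h + 1))\<bar> ^ r * \<bar>real_of_int (v k 0)\<bar>"
        unfolding z0 by (simp add: abs_mult power_abs)
      also have "\<dots> \<le> H ^ r * X" using a_le v0 H1 by (intro mult_mono power_mono) auto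
      also have "\<dots> = Y" unfolding X_def Y_def using H1 by (simp add: powr_add powr_realpow)
      finally show ?thesis .
    qed
    moreover have "\<bar>\<zeta> ^ i * of_int (z k 0) - of_int (z k i)\<bar> \<le> Y powr - l" if "i \<in> {1..n}" for i
    proof -
      have "i \<le> h + r" unfolding r_def using that hn by auto
      from z(2)[OF k this] err show ?thesis unfolding z0 by (simp add: mult_ac)
    qed
    ultimately show ?thesis unfolding simult_approx_def by blast
  qed
  moreover have "lin_indep_int n j z"
    unfolding lin_indep_int_def
  proof (intro allI impI)
    fix c :: "nat \<Rightarrow> int" and k assume c: "\<forall>i\<le>n. (\<Sum>k<j. c k * z k i) = 0" and k: "k < j"
    have "(\<Sum>k<j. c k * v k i) = 0" if "i \<le> h" for i
    proof -
      have "0 = (\<Sum>k<j. c k * z k i)" using c that hn by simp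
      also have "\<dots> = (\<Sum>k<j. a (h + 1) ^ r * (c k * v k i))"
        using z(1) that by (intro sum.cong) auto
      also have "\<dots> = a (h + 1) ^ r * (\<Sum>k<j. c k * v k i)" by (simp only: sum_distrib_left)
      finally show ?thesis using a0 by simp
    qed
    with v(1) k show "c k = 0" unfolding lin_indep_int_def by blast
  qed
  moreover have "Y \<ge> X0" unfolding Y_def using B2(2)[OF H(2)] .
  ultimately show "\<exists>X\<ge>X0. lambda_solvable n j \<zeta> l X" unfolding lambda_solvable_def by blast
qed

section \<open>Consequences for the exponents\<close>

lemma w_exponent_ge_of_lambda:
  assumes trans: "\<And>Q. Q \<noteq> 0 \<Longrightarrow> poly (map_poly of_int Q) \<zeta> \<noteq> (0::real)"
    and n: "n \<ge> 1" and l: "l > 0" and adm: "lambda_admissible n 1 \<zeta> l"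
  shows "ereal (real n * l + real n - 1) \<le> w_exponent n \<zeta>"
proof (rule ereal_le_if_reals_below)
  fix z assume "ereal z < ereal (real n * l + real n - 1)"
  moreover have "real n * l > 0" using n l by simp
  moreover have "real n \<ge> 1" using n by simp
  ultimately have "0 \<le> max z 0" "max z 0 < real n * l + real n - 1" by auto
  from infinite_approximants_if_lambda_admissible[OF trans n l adm this]
  have "ereal (max z 0) \<le> w_exponent n \<zeta>" by (rule w_exponent_ge)
  moreover have "ereal z \<le> ereal (max z 0)" by simp
  ultimately show "ereal z \<le> w_exponent n \<zeta>" by (rule order_trans[rotated])
qed

text \<open>Obtained from simultaneous approximation: as \<open>l\<close> tends to Dirichlet's
  exponent \<open>1 / n\<close>, the transferred bound \<open>n * l + n - 1\<close> tends to
  \<open>n\<close>.\<close>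

lemma w_exponent_ge_degree:
  assumes trans: "\<And>Q. Q \<noteq> 0 \<Longrightarrow> poly (map_poly of_int Q) \<zeta> \<noteq> (0::real)" and n: "n \<ge> 1"
  shows "ereal (real n) \<le> w_exponent n \<zeta>"
proof (rule ereal_le_if_reals_below)
  fix z assume "ereal z < ereal (real n)"
  then have z: "z < real n" by simp
  have n0: "real n > 0" using n by simp
  \<comment> \<open>The second argument solves \<open>n * l + n - 1 = z\<close>; the first keeps
    \<open>l\<close> positive.\<close>
  define l where "l = max (1 / (2 * real n)) ((z + 1 - real n) / real n)"
  have "1 / (2 * real n) > 0" "1 / (2 * real n) < 1 / real n" using n0 by (auto simp: field_simps)
  moreover have "(z + 1 - real n) / real n < 1 / real n"
    using z n0 by (intro divide_strict_right_mono) auto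
  ultimately have l: "l > 0" "l < 1 / real n" unfolding l_def by auto
  have "lambda_admissible n 1 \<zeta> l"
    using dirichlet_uniform[OF n l(2)] by (rule lambda_uniform_imp_admissible)
  from w_exponent_ge_of_lambda[OF trans n l(1) this]
  have "ereal (real n * l + real n - 1) \<le> w_exponent n \<zeta>" .
  moreover have "(z + 1 - real n) / real n \<le> l" unfolding l_def by simp
  then have "ereal z \<le> ereal (real n * l + real n - 1)" using n0 by (simp add: field_simps)
  ultimately show "ereal z \<le> w_exponent n \<zeta>" by (rule order_trans[rotated])
qed

lemma lambda_exponent_ge_of_w:
  assumes n: "n \<ge> 1" and w: "w > 0" and inf: "infinite (w_approximants n \<zeta> w)"
  shows "ereal (w / (real n + (real n - 1) * w)) \<le> lambda_exponent n 1 \<zeta>"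
proof (rule ereal_le_if_reals_below)
  fix z assume "ereal z < ereal (w / (real n + (real n - 1) * w))"
  then have "z < w / (real n + (real n - 1) * w)" by simp
  then show "ereal z \<le> lambda_exponent n 1 \<zeta>"
    by (intro lambda_exponent_ge lambda_admissible_if_infinite_approximants[OF n w inf])
qed

text \<open>The transference bounds \<open>n * l + n - 1\<close> and
  \<open>w / (n + (n - 1) * w)\<close> are increasing and both match \<open>l = 1 / n\<close> with
  \<open>w = n\<close>. These values are lower bounds for the exponents, so exceeding one of them
  forces exceeding the other.\<close>

lemma w_eq_degree_iff_lambda_eq_inverse:
  assumes trans: "\<And>Q. Q \<noteq> 0 \<Longrightarrow> poly (map_poly of_int Q) \<zeta> \<noteq> (0::real)" and n: "n \<ge> 1"
  shows "w_exponent n \<zeta> = ereal (real n) \<longleftrightarrow> lambda_exponent n 1 \<zeta> = ereal (1 / real n)"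
proof
  assume w: "w_exponent n \<zeta> = ereal (real n)"
  show "lambda_exponent n 1 \<zeta> = ereal (1 / real n)"
  proof (rule ccontr)
    assume "lambda_exponent n 1 \<zeta> \<noteq> ereal (1 / real n)"
    with lambda_exponent_ge_inverse[OF n, of \<zeta>] have "ereal (1 / real n) < lambda_exponent n 1 \<zeta>" by simp
    then obtain l where l: "ereal (1 / real n) < ereal l" "ereal l < lambda_exponent n 1 \<zeta>"
      using ereal_dense2 by blast
    then have l': "1 / real n < l" by simp
    moreover have "1 / real n > 0" using n by simp
    ultimately have "l > 0" by linarith
    from w_exponent_ge_of_lambda[OF trans n this lambda_admissible_if_less[OF l(2)]] w
    have "real n * l \<le> 1" by simp
    with l' n show False by (simp add: field_simps)
  qed
next
  assume lam: "lambda_exponent n 1 \<zeta> = ereal (1 / real n)"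
  show "w_exponent n \<zeta> = ereal (real n)"
  proof (rule ccontr)
    assume "w_exponent n \<zeta> \<noteq> ereal (real n)"
    with w_exponent_ge_degree[OF trans n] have "ereal (real n) < w_exponent n \<zeta>" by simp
    then obtain w where w: "ereal (real n) < ereal w" "ereal w < w_exponent n \<zeta>"
      using ereal_dense2 by blast
    then have nw: "real n < w" by simp
    then have w0: "w > 0" by linarith
    have "w / (real n + (real n - 1) * w) \<le> 1 / real n"
      using lambda_exponent_ge_of_w[OF n w0 infinite_approximants_if_less_w[OF w(2)]] lam by simp
    moreover have "real n + (real n - 1) * w > 0" using n w0 by (intro add_pos_nonneg) auto
    ultimately have "w * real n \<le> real n + (real n - 1) * w" using n by (simp add: divide_simps)
    then have "w \<le> real n" by (simp add: algebra_simps)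
    with nw show False by simp
  qed
qed

text \<open>For \<open>n = 1\<close> both transference bounds are the identity; values
  \<open>z \<le> 0\<close> are covered by the lower bound 1 for either exponent.\<close>

lemma w_1_eq_lambda_1:
  assumes trans: "\<And>Q. Q \<noteq> 0 \<Longrightarrow> poly (map_poly of_int Q) \<zeta> \<noteq> (0::real)"
  shows "w_exponent 1 \<zeta> = lambda_exponent 1 1 \<zeta>"
proof (rule antisym; rule ereal_le_if_reals_below)
  fix z assume z: "ereal z < w_exponent 1 \<zeta>"
  show "ereal z \<le> lambda_exponent 1 1 \<zeta>"
  proof (cases "z > 0")
    case True
    from lambda_exponent_ge_of_w[OF _ this infinite_approximants_if_less_w[OF z]] show ?thesis by simp
  next
    case False
    then have "ereal z \<le> ereal (1 / real 1)" by simp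
    also have "\<dots> \<le> lambda_exponent 1 1 \<zeta>" by (rule lambda_exponent_ge_inverse) simp
    finally show ?thesis .
  qed
next
  fix z assume z: "ereal z < lambda_exponent 1 1 \<zeta>"
  show "ereal z \<le> w_exponent 1 \<zeta>"
  proof (cases "z > 0")
    case True
    from w_exponent_ge_of_lambda[OF trans _ this lambda_admissible_if_less[OF z]] show ?thesis by simp
  next
    case False
    then have "ereal z \<le> ereal (real 1)" by simp
    also have "\<dots> \<le> w_exponent 1 \<zeta>" by (rule w_exponent_ge_degree[OF trans]) simp_all
    finally show ?thesis .
  qed
qed

section \<open>Exponents under the condition
  \<open>w_exponent (h + 1) \<zeta> = \<infinity>\<close>\<close>

lemma lambda_exponent_geI:
  assumes "\<tau> > 0" "\<And>l. 0 < l \<Longrightarrow> l < \<tau> \<Longrightarrow> lambda_admissible n j \<zeta> l"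
  shows "ereal \<tau> \<le> lambda_exponent n j \<zeta>"
proof (rule ereal_le_if_reals_below)
  fix z assume "ereal z < ereal \<tau>"
  with assms(1) have "ereal (max z (\<tau> / 2)) \<le> lambda_exponent n j \<zeta>"
    by (intro lambda_exponent_ge assms(2)) (auto simp: less_max_iff_disj)
  moreover have "ereal z \<le> ereal (max z (\<tau> / 2))" by simp
  ultimately show "ereal z \<le> lambda_exponent n j \<zeta>" by (rule order_trans[rotated])
qed

lemma lambda_exponent_le_lower_dim:
  assumes "k \<le> n" "j \<ge> 1"
  shows "lambda_exponent n j \<zeta> \<le> lambda_exponent k 1 \<zeta>"
proof (rule ereal_le_if_reals_below)
  fix z assume "ereal z < lambda_exponent n j \<zeta>"
  from lambda_admissible_fewer[OF lambda_admissible_if_less[OF this] assms(2)] assms(1)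
  have "lambda_admissible k 1 \<zeta> z" by (rule lambda_admissible_lower_dim)
  then show "ereal z \<le> lambda_exponent k 1 \<zeta>" by (rule lambda_exponent_ge)
qed

text \<open>Prolongation starts from Dirichlet's theorem in dimension \<open>h\<close>; for
  \<open>n < h\<close>, Dirichlet's bound \<open>1 / n\<close> is already larger.\<close>

lemma lambda_exponent_U_ge:
  assumes winf: "w_exponent (h + 1) \<zeta> = \<infinity>" and h: "h \<ge> 1" and n: "n \<ge> 1"
  shows "ereal (1 / real h) \<le> lambda_exponent n 1 \<zeta>"
proof (cases "h \<le> n")
  case True
  show ?thesis
    by (rule lambda_exponent_geI[OF _ lambda_admissible_prolong[OF winf True]])
      (use h dirichlet_uniform in auto)
next
  case False
  then have "1 / real h \<le> 1 / real n" using n by (intro divide_left_mono) auto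
  then have "ereal (1 / real h) \<le> ereal (1 / real n)" by simp
  also have "\<dots> \<le> lambda_exponent n 1 \<zeta>" using n by (rule lambda_exponent_ge_inverse)
  finally show ?thesis .
qed

text \<open>From above, dropping coordinates and all but one vector leads back to
  \<open>lambda_exponent h 1 \<zeta>\<close>. From below, \<open>h + 1\<close> independent solutions
  in dimension \<open>h\<close> exist at every large scale and stay independent when
  prolonged.\<close>

lemma lambda_exponent_U_eq:
  assumes winf: "w_exponent (h + 1) \<zeta> = \<infinity>" and h: "h \<ge> 1"
    and lam: "lambda_exponent h 1 \<zeta> = ereal (1 / real h)"
    and "h \<le> n" "1 \<le> j" "j \<le> h + 1"
  shows "lambda_exponent n j \<zeta> = ereal (1 / real h)"
proof (rule antisym)
  show "lambda_exponent n j \<zeta> \<le> ereal (1 / real h)"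
    using lambda_exponent_le_lower_dim[of h n j \<zeta>] assms by simp
  have not_adm: "\<not> lambda_admissible h 1 \<zeta> l" if "l > 1 / real h" for l
    using lambda_exponent_ge[of h 1 \<zeta> l] lam that by auto
  show "ereal (1 / real h) \<le> lambda_exponent n j \<zeta>"
  proof (rule lambda_exponent_geI)
    fix l assume l: "0 < l" "l < 1 / real h"
    have "lambda_admissible n (h + 1) \<zeta> l"
      using lambda_uniform_all_indices[OF h not_adm]
      by (rule lambda_admissible_prolong[OF winf \<open>h \<le> n\<close> _ l])
    then show "lambda_admissible n j \<zeta> l" using \<open>j \<le> h + 1\<close> by (rule lambda_admissible_fewer)
  qed (use h in simp)
qed

text \<open>If \<open>l > 1\<close>, a good approximation \<open>(x, y\<^sub>1, y\<^sub>2)\<close> satisfies \<open>y\<^sub>1\<^sup>2 = x y\<^sub>2\<close>, so the denominator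
  \<open>a\<close> of \<open>y\<^sub>1 / x\<close> in lowest terms has \<open>a\<^sup>2\<close> dividing \<open>x\<close>.\<close>

lemma lambda_admissible_2_double:
  fixes \<zeta> :: real
  assumes adm: "lambda_admissible 2 1 \<zeta> l" and l: "l > 1"
  shows "lambda_admissible 1 1 \<zeta> (2 * l)"
  unfolding lambda_admissible_def lambda_solvable_1_iff
proof
  fix X0 :: real
  have "l - 1 > 0" using l by simp
  from const_le_powr[OF this, of "2 * \<bar>\<zeta>\<bar> + 3"] obtain X1 where
    X1: "X1 \<ge> 1" "\<And>X. X \<ge> X1 \<Longrightarrow> 2 * \<bar>\<zeta>\<bar> + 3 \<le> X powr (l - 1)" by metis
  from adm obtain X u where X: "X \<ge> max X1 (X0\<^sup>2)" and u: "simult_approx 2 \<zeta> l X u"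
    unfolding lambda_admissible_def lambda_solvable_1_iff by blast
  have X_1: "X \<ge> 1" using X X1 by simp
  define x y where "x = u 0" and "y = u 1"
  define e where "e = (\<lambda>i. \<zeta> ^ i * real_of_int x - real_of_int (u i))"
  have x: "1 \<le> \<bar>x\<bar>" "\<bar>real_of_int x\<bar> \<le> X" using u unfolding simult_approx_def x_def by auto
  have "\<forall>i\<in>{1..2}. \<bar>e i\<bar> \<le> X powr - l"
    using u unfolding simult_approx_def e_def x_def by blast
  then have e_le: "\<bar>e 1\<bar> \<le> X powr - l" "\<bar>e 2\<bar> \<le> X powr - l" by auto
  define \<delta> where "\<delta> = X * X powr - l"
  have \<delta>: "X powr - l \<le> \<delta>" "X powr - l \<le> 1"
  proof -
    show "X powr - l \<le> \<delta>" unfolding \<delta>_def using X_1 mult_right_mono[of 1 X "X powr - l"] by simp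
    show "X powr - l \<le> 1" using powr_mono[of "- l" 0 X] X_1 l by simp
  qed
  \<comment> \<open>This integer is of order \<open>X * X powr - l\<close>, so it vanishes for large
    \<open>X\<close> because \<open>l > 1\<close>.\<close>
  have "real_of_int (y\<^sup>2 - x * u 2) = (e 1)\<^sup>2 - 2 * \<zeta> * (of_int x * e 1) + of_int x * e 2"
    unfolding e_def x_def y_def by (simp add: power2_eq_square algebra_simps)
  moreover have "\<bar>(e 1)\<^sup>2\<bar> \<le> \<delta>"
  proof -
    have "\<bar>(e 1)\<^sup>2\<bar> = \<bar>e 1\<bar> * \<bar>e 1\<bar>" by (simp add: power2_eq_square abs_mult)
    also have "\<dots> \<le> 1 * \<delta>" using e_le(1) \<delta> by (intro mult_mono) auto
    finally show ?thesis by simp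
  qed
  moreover have xe: "\<bar>of_int x * e 1\<bar> \<le> \<delta>" "\<bar>of_int x * e 2\<bar> \<le> \<delta>"
    unfolding \<delta>_def abs_mult using x e_le X_1 by (auto intro!: mult_mono)
  moreover have "\<bar>2 * \<zeta> * (of_int x * e 1)\<bar> \<le> 2 * \<bar>\<zeta>\<bar> * \<delta>"
    using xe(1) by (subst abs_mult) (auto simp: abs_mult intro!: mult_left_mono)
  ultimately have "\<bar>real_of_int (y\<^sup>2 - x * u 2)\<bar> \<le> \<delta> + 2 * \<bar>\<zeta>\<bar> * \<delta> + \<delta>" by linarith
  also have "\<dots> < (2 * \<bar>\<zeta>\<bar> + 3) * \<delta>"
    using X_1 unfolding \<delta>_def by (simp add: algebra_simps)
  also have "\<dots> \<le> X powr (l - 1) * \<delta>"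
    using X1(2)[of X] X X_1 unfolding \<delta>_def by (intro mult_right_mono) auto
  also have "\<dots> = 1"
    unfolding \<delta>_def using X_1 by (simp add: powr_diff powr_minus field_simps)
  finally have "y\<^sup>2 - x * u 2 = 0" by linarith
  then have sq: "y\<^sup>2 = x * u 2" by simp
  define g where "g = gcd x y"
  have "x \<noteq> 0" using x by auto
  then have g0: "g \<noteq> 0" unfolding g_def by simp
  obtain a b where ab: "x = g * a" "y = g * b" "coprime a b"
    using gcd_coprime_exists[of x y] g0 unfolding g_def by (metis mult.commute)
  have a0: "a \<noteq> 0" using ab(1) \<open>x \<noteq> 0\<close> by auto
  have "g * (g * b\<^sup>2) = g * (a * u 2)" using sq unfolding ab(1,2) by (simp add: power2_eq_square algebra_simps)
  then have "g * b\<^sup>2 = a * u 2" using g0 by simp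
  then have "a dvd g * b\<^sup>2" by simp
  moreover have "coprime a (b\<^sup>2)" using ab(3) by simp
  ultimately have "a dvd g" by (simp add: coprime_dvd_mult_left_iff)
  then have ag: "\<bar>a\<bar> \<le> \<bar>g\<bar>" using g0 by (simp add: dvd_imp_le_int)
  define v where "v = (\<lambda>i::nat. if i = 0 then a else b)"
  define X' where "X' = sqrt X"
  have "simult_approx 1 \<zeta> (2 * l) X' v"
  proof -
    have "a\<^sup>2 \<le> \<bar>x\<bar>"
    proof -
      have "a\<^sup>2 = \<bar>a\<bar> * \<bar>a\<bar>" by (simp add: power2_eq_square)
      also have "\<dots> \<le> \<bar>g\<bar> * \<bar>a\<bar>" using ag by (intro mult_right_mono) auto
      finally show ?thesis unfolding ab(1) by (simp add: abs_mult)
    qed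
    then have "real_of_int (a\<^sup>2) \<le> real_of_int \<bar>x\<bar>" by (simp only: of_int_le_iff)
    with x(2) have "(real_of_int a)\<^sup>2 \<le> X" by simp
    then have "\<bar>real_of_int a\<bar> \<le> X'" unfolding X'_def by (rule real_le_rsqrt[of "\<bar>real_of_int a\<bar>", simplified power2_abs])
    moreover have "1 \<le> \<bar>a\<bar>" using a0 by linarith
    moreover have "\<bar>\<zeta> * of_int a - of_int b\<bar> \<le> X' powr - (2 * l)"
    proof -
      have "e 1 = of_int g * (\<zeta> * of_int a - of_int b)"
        unfolding e_def y_def[symmetric] ab(1,2) by (simp add: algebra_simps)
      then have "\<bar>e 1\<bar> = \<bar>of_int g\<bar> * \<bar>\<zeta> * of_int a - of_int b\<bar>" by (simp only: abs_mult)
      moreover have "1 * \<bar>\<zeta> * of_int a - of_int b\<bar> \<le> \<bar>real_of_int g\<bar> * \<bar>\<zeta> * of_int a - of_int b\<bar>"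
        using g0 by (intro mult_right_mono) linarith+
      ultimately have "\<bar>\<zeta> * of_int a - of_int b\<bar> \<le> \<bar>e 1\<bar>" by simp
      also note e_le(1)
      also have "X powr - l = X' powr - (2 * l)"
        unfolding X'_def using X_1 by (simp add: powr_half_sqrt[symmetric] powr_powr)
      finally show ?thesis .
    qed
    ultimately show ?thesis unfolding simult_approx_def v_def by auto
  qed
  moreover have "X' \<ge> X0" unfolding X'_def using X by (intro real_le_rsqrt) simp
  ultimately show "\<exists>X\<ge>X0. \<exists>u. simult_approx 1 \<zeta> (2 * l) X u" by blast
qed

text \<open>An exponent \<open>l > 1\<close> in dimension 2 would give \<open>2 * l > 2\<close> in
  dimension 1. This is where the bound \<open>w \<le> 2\<close> of the third claim enters.\<close>

lemma lambda_2_le_1: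
  assumes "lambda_exponent 1 1 \<zeta> \<le> 2"
  shows "lambda_exponent 2 1 \<zeta> \<le> 1"
proof (rule ccontr)
  assume "\<not> ?thesis"
  then have "ereal 1 < lambda_exponent 2 1 \<zeta>" by (simp add: one_ereal_def)
  then obtain l where l: "ereal 1 < ereal l" "ereal l < lambda_exponent 2 1 \<zeta>"
    using ereal_dense2 by blast
  from l(1) have l1: "l > 1" by simp
  from lambda_exponent_ge[OF lambda_admissible_2_double[OF lambda_admissible_if_less[OF l(2)] l1]] assms
  have "ereal (2 * l) \<le> 2" by (rule order_trans)
  then show False using l1 by simp
qed

theorem theorem3p3:
  fixes m :: nat and \<zeta> :: real
  assumes "m \<ge> 2" and "U_number m \<zeta>"
  shows "(\<forall>n\<ge>1. lambda_exponent n 1 \<zeta> \<ge> ereal (1 / (real m - 1)))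
    \<and> (w_exponent (m - 1) \<zeta> = ereal (real m - 1) \<longleftrightarrow>
         (\<forall>n\<ge>m - 1. \<forall>j\<in>{1..m}. lambda_exponent n j \<zeta> = ereal (1 / (real m - 1))))
    \<and> (\<forall>w\<in>{1..2 :: real}.
         (w_exponent 1 \<zeta> = ereal w \<and> (\<forall>t\<in>{2..m - 1}. w_exponent t \<zeta> = ereal (real t))) \<longleftrightarrow>
         (lambda_exponent 1 1 \<zeta> = ereal w
          \<and> (\<forall>n\<in>{2..m - 1}. lambda_exponent n 1 \<zeta> = ereal (1 / real n))
          \<and> (\<forall>n\<ge>m. lambda_exponent n 1 \<zeta> = ereal (1 / (real m - 1)))))"
proof -
  define h where "h = m - 1"
  have h: "h \<ge> 1" and m: "m = h + 1" using assms(1) unfolding h_def by auto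
  have rm: "real m - 1 = real h" using m by simp
  have winf: "w_exponent (h + 1) \<zeta> = \<infinity>" using assms(2) unfolding U_number_def m by simp
  note trans = transcendental_if_w_infinite[OF winf]
  note equiv = w_eq_degree_iff_lambda_eq_inverse[OF trans]
  have lower: "lambda_exponent n 1 \<zeta> \<ge> ereal (1 / real h)" if "n \<ge> 1" for n
    using lambda_exponent_U_ge[OF winf h that] .
  have part2: "w_exponent h \<zeta> = ereal (real h) \<longleftrightarrow>
    (\<forall>n\<ge>h. \<forall>j\<in>{1..h + 1}. lambda_exponent n j \<zeta> = ereal (1 / real h))" (is "?L \<longleftrightarrow> ?R")
  proof
    assume ?L
    then have "lambda_exponent h 1 \<zeta> = ereal (1 / real h)" using equiv[OF _ h] by simp
    then show ?R using lambda_exponent_U_eq[OF winf h] by simp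
  next
    assume ?R
    then have "lambda_exponent h 1 \<zeta> = ereal (1 / real h)" by simp
    then show ?L using equiv[OF _ h] by simp
  qed
  have part3: "(w_exponent 1 \<zeta> = ereal w \<and> (\<forall>t\<in>{2..h}. w_exponent t \<zeta> = ereal (real t))) \<longleftrightarrow>
         (lambda_exponent 1 1 \<zeta> = ereal w
          \<and> (\<forall>n\<in>{2..h}. lambda_exponent n 1 \<zeta> = ereal (1 / real n))
          \<and> (\<forall>n\<ge>h + 1. lambda_exponent n 1 \<zeta> = ereal (1 / real h)))" (is "?L \<longleftrightarrow> ?R")
    if w: "w \<in> {1..2}" for w
  proof
    assume L: ?L
    then have lam1: "lambda_exponent 1 1 \<zeta> = ereal w" using w_1_eq_lambda_1[OF trans] by simp
    moreover have "\<forall>n\<in>{2..h}. lambda_exponent n 1 \<zeta> = ereal (1 / real n)" using L equiv by simp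
    moreover have "lambda_exponent n 1 \<zeta> = ereal (1 / real h)" if n: "n \<ge> h + 1" for n
    proof (cases "h = 1")
      \<comment> \<open>Here \<open>h \<ge> 2\<close>, so \<open>t = h\<close> lies in the range
        \<open>{2..h}\<close> of the assumed equalities.\<close>
      case False
      then have "w_exponent h \<zeta> = ereal (real h)" using L h by simp
      with part2 n show ?thesis by simp
    next
      \<comment> \<open>Here \<open>m = 2\<close> and \<open>{2..h}\<close> is empty; as
        \<open>w\<close> may exceed 1, \<open>part2\<close> cannot be invoked. The bound in
        dimension 2 passes to all \<open>n \<ge> 2\<close> by dropping coordinates.\<close>
      case True
      have "lambda_exponent 1 1 \<zeta> \<le> 2" unfolding lam1 using w by simp
      then have "lambda_exponent 2 1 \<zeta> \<le> 1" by (rule lambda_2_le_1)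
      with lambda_exponent_le_lower_dim[of 2 n 1 \<zeta>] n True have "lambda_exponent n 1 \<zeta> \<le> 1" by simp
      moreover have "lambda_exponent n 1 \<zeta> \<ge> 1" using lower[of n] n True by (simp add: one_ereal_def)
      ultimately show ?thesis using True by (simp add: one_ereal_def)
    qed
    ultimately show ?R by blast
  next
    assume ?R
    then show ?L using w_1_eq_lambda_1[OF trans] equiv by simp
  qed
  show ?thesis unfolding h_def[symmetric] rm using lower part2 part3 unfolding m by blast
qed

end
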